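(* Suppose $0\le\alpha<n$, $1<p<n/\alpha$ (with $n/\alpha=\infty$ if $\alpha=0$), and $q$ is defined by the relationship $1/q=1/p-\alpha/n$. If $w\in A_{p,q}$, then $$\|w\,M_\alpha f\|_{L^q(\mathbb{R}^n)}\le c\,[w]_{A_{p,q}}^{\frac{p'}{q}(1-\frac{\alpha}{n})}\,\|wf\|_{L^p(\mathbb{R}^n)}$$ for all $f$ with $wf\in L^p(\mathbb{R}^n)$, where the constant $c$ is independent of $w$ and $f$. Furthermore, the exponent $\frac{p'}{q}(1-\frac{\alpha}{n})$ is sharp: for no $\beta<\frac{p'}{q}(1-\frac{\alpha}{n})$ is there a constant $c$ such that the inequality with the exponent $\frac{p'}{q}(1-\frac{\alpha}{n})$ replaced by $\beta$ holds for all $w\in A_{p,q}$ and all such $f$.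
   Context: For $0\le\alpha<n$, the fractional maximal operator is $M_\alpha f(x)=\sup_{Q\ni x}\frac1{|Q|^{1-\alpha/n}}\int_Q|f(y)|\,dy$, the supremum being over cubes $Q\subset\mathbb{R}^n$ with sides parallel to the axes containing $x$ ($M_0=M$ is the Hardy–Littlewood maximal function). A weight is a non-negative locally integrable function on $\mathbb{R}^n$; $p'$ is defined by $1/p+1/p'=1$. For $1<p\le q<\infty$, a weight $w$ belongs to $A_{p,q}$ if $$[w]_{A_{p,q}}=\sup_Q\left(\frac1{|Q|}\int_Q w^q\,dx\right)\left(\frac1{|Q|}\int_Q w^{-p'}\,dx\right)^{q/p'}<\infty,$$ the supremum being over all such cubes $Q$. *)

theory Defs
  imports "HOL-Analysis.Analysis"
begin

text \<open>Real powers of extended non-negative numbers. Unlike \<^const>\<open>powr\<close>, negative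
  powers of \<open>0\<close> are \<open>\<infinity>\<close>, so negative powers of a weight are infinite where it vanishes.\<close>

definition epowr :: "ennreal \<Rightarrow> real \<Rightarrow> ennreal"
  where "epowr x a =
    (if a = 0 then 1
     else if x = 0 then (if a > 0 then 0 else \<infinity>)
     else if x = \<infinity> then (if a > 0 then \<infinity> else 0)
     else ennreal (enn2real x powr a))"

definition conj_exponent :: "real \<Rightarrow> real"
  where "conj_exponent p = p / (p - 1)"

lemma conj_exponent_iff: "1 < p \<Longrightarrow> 1 / p + 1 / r = 1 \<longleftrightarrow> r = conj_exponent p"
  by (cases "r = 0") (auto simp: conj_exponent_def field_simps)

definition cubes :: "(real ^ 'n) set set"
  where "cubes = {cbox a b | a b. \<exists>l > 0. \<forall>i. b $ i - a $ i = l}"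

definition frac_maximal :: "real \<Rightarrow> (real ^ 'n \<Rightarrow> real) \<Rightarrow> real ^ 'n \<Rightarrow> ennreal"
  where "frac_maximal \<alpha> f x =
    (SUP Q \<in> {Q \<in> cubes. x \<in> Q}.
      ennreal (1 / measure lebesgue Q powr (1 - \<alpha> / CARD('n))) *
      (\<integral>\<^sup>+ y \<in> Q. ennreal \<bar>f y\<bar> \<partial>lebesgue))"

definition weight :: "(real ^ 'n \<Rightarrow> real) \<Rightarrow> bool"
  where "weight w \<longleftrightarrow> (\<forall>x. 0 \<le> w x) \<and> (\<forall>K. compact K \<longrightarrow> w absolutely_integrable_on K)"

definition average :: "(real ^ 'n) set \<Rightarrow> (real ^ 'n \<Rightarrow> ennreal) \<Rightarrow> ennreal"
  where "average Q F = ennreal (1 / measure lebesgue Q) * (\<integral>\<^sup>+ x \<in> Q. F x \<partial>lebesgue)"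

definition Apq_const :: "real \<Rightarrow> real \<Rightarrow> (real ^ 'n \<Rightarrow> real) \<Rightarrow> ennreal"
  where "Apq_const p q w =
    (SUP Q \<in> cubes.
      average Q (\<lambda>x. epowr (ennreal (w x)) q) *
      epowr (average Q (\<lambda>x. epowr (ennreal (w x)) (- conj_exponent p)))
        (q / conj_exponent p))"

text \<open>As \<open>0 * \<infinity> = 0\<close> in \<^typ>\<open>ennreal\<close>, the only members of the following class that vanish
  on a set of positive measure are those that vanish almost everywhere.\<close>

definition Apq :: "real \<Rightarrow> real \<Rightarrow> (real ^ 'n \<Rightarrow> real) set"
  where "Apq p q = {w. weight w \<and> Apq_const p q w < \<infinity>}"

definition Lp_norm :: "real \<Rightarrow> (real ^ 'n \<Rightarrow> ennreal) \<Rightarrow> ennreal"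
  where "Lp_norm p F = epowr (\<integral>\<^sup>+ x. epowr (F x) p \<partial>lebesgue) (1 / p)"

definition in_Lp :: "real \<Rightarrow> (real ^ 'n \<Rightarrow> real) \<Rightarrow> bool"
  where "in_Lp p g \<longleftrightarrow> g \<in> borel_measurable lebesgue \<and> Lp_norm p (\<lambda>x. ennreal \<bar>g x\<bar>) < \<infinity>"

end

theory Submission
  imports Defs
begin

text \<open>
  Write \<open>u = w powr q\<close>, \<open>s = w powr (- p')\<close>, \<open>\<gamma> = 1 - \<alpha> / n = 1 / p' + 1 / q\<close> and
  \<open>\<theta> = p' / q * \<gamma>\<close>, the exponent of the theorem.

  \<^emph>\<open>Upper bound.\<close> Every cube lies in a cell of comparable size of one of \<open>2 ^ n\<close> shifted dyadic
  grids (\<open>cube_in_grid\<close>), so it suffices to bound, for each grid, the supremum of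
  \<open>|Q| powr (- \<gamma>) * (\<integral>\<^sub>Q |f|)\<close> over the grid cells \<open>Q\<close> containing a point. A grid is a countable
  laminar family: two cells are nested or disjoint. For such a family the maximal operator with
  respect to \<^emph>\<open>any\<close> sigma-finite measure that is finite on its members is bounded on every \<open>L\<^sup>r\<close>,
  \<open>r > 1\<close>, with a constant depending on \<open>r\<close> only (\<open>maximal_strong_type\<close>). The weight enters just once: on a cell the \<open>A\<^bsub>p,q\<^esub>\<close> condition gives
  \<open>|Q| powr (- \<gamma>) * (\<integral>\<^sub>Q |f|) \<le> [w] powr \<theta> * (1 / u(Q) * \<integral>\<^sub>Q N powr (1 / \<theta>)) powr \<theta>\<close>,
  where \<open>N\<close> is the supremum of \<open>s(Q) powr (- \<gamma>) * (\<integral>\<^sub>Q |f|)\<close> (\<open>fractional_mean_le\<close>). The right-hand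
  side is a power of a mean with respect to \<open>u dx\<close>, and \<open>N\<close> is at most a constant times a power of
  the maximal function of \<open>f / s\<close> with respect to \<open>s dx\<close> (\<open>N_le\<close>). Applying the maximal theorem for
  \<open>u dx\<close> with exponent \<open>\<theta> * q = 1 + p' / q\<close> and then the one for \<open>s dx\<close> with exponent \<open>p\<close> yields
  the bound (\<open>weighted_bound\<close>). This extends Lerner's argument for the Hardy--Littlewood maximal
  operator. A weight of finite constant is positive almost everywhere unless it vanishes almost
  everywhere (\<open>Apq_ae_positive\<close>), so null sets apart the powers of \<open>w\<close> are real functions.

  \<^emph>\<open>Sharpness.\<close> With \<open>R\<close> the maximum norm and \<open>0 < d < 1\<close>, take \<open>w = R powr ((n - d) / p')\<close> and
  \<open>f = R powr (d - n)\<close> on the unit ball of \<open>R\<close>, zero elsewhere. Then \<open>[w]\<close> is at most of order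
  \<open>d powr (- q / p')\<close> and the norm of \<open>w f\<close> at most of order \<open>d powr (- 1 / p)\<close>, while the norm of
  \<open>w M\<^sub>\<alpha> f\<close> is at least of order \<open>d powr (- 1 - 1 / q)\<close>. A bound with exponent \<open>\<beta> \<ge> 0\<close> would force
  \<open>\<beta> * q / p' + 1 / p \<ge> 1 + 1 / q\<close>, that is \<open>\<beta> \<ge> \<theta>\<close>, on letting \<open>d\<close> tend to \<open>0\<close>. Since \<open>[w]\<close> is
  bounded below uniformly in \<open>d\<close>, a bound with a negative exponent would imply one with exponent \<open>0\<close>.
\<close>

section \<open>Extended powers and the layer cake formula\<close>

lemma epowr_ennreal_pos: "0 < x \<Longrightarrow> epowr (ennreal x) a = ennreal (x powr a)"
  by (auto simp: epowr_def)

lemma epowr_ennreal: "0 \<le> x \<Longrightarrow> 0 < a \<Longrightarrow> epowr (ennreal x) a = ennreal (x powr a)"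
  by (cases "x = 0") (auto simp: epowr_def)

lemma epowr_zero: "0 < a \<Longrightarrow> epowr 0 a = 0"
  by (simp add: epowr_def)

lemma epowr_top: "0 < a \<Longrightarrow> epowr \<infinity> a = \<infinity>"
  by (simp add: epowr_def)

lemma epowr_mono:
  assumes "0 \<le> a" "x \<le> y" shows "epowr x a \<le> epowr y a"
proof (cases "a = 0")
  case False
  then have a: "0 < a" using assms by simp
  show ?thesis
  proof (cases y)
    case (real r)
    obtain s where "x = ennreal s" "0 \<le> s" "s \<le> r"
      using assms real by (cases x) (auto simp: top_unique)
    then show ?thesis using real a by (simp add: epowr_ennreal powr_mono2)
  qed (use a in \<open>auto simp: epowr_def\<close>)
qed (simp add: epowr_def)

text \<open>
  For \<open>a > 0\<close> the convention \<open>0 * \<infinity> = 0\<close> is respected by the powers. For \<open>a < 0\<close> it is not: with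
  \<open>x = 0\<close> and \<open>y = \<infinity>\<close> the left-hand side would be \<open>\<infinity>\<close> and the right-hand side \<open>0\<close>.
\<close>

lemma epowr_mult:
  assumes "0 \<le> a" shows "epowr (x * y) a = epowr x a * epowr y a"
proof (cases "a = 0")
  case False
  then have a: "0 < a" using assms by simp
  show ?thesis
  proof (cases "x = 0 \<or> y = 0")
    case True
    then show ?thesis using a by (auto simp: epowr_zero)
  next
    case nz: False
    show ?thesis
    proof (cases "x = \<infinity> \<or> y = \<infinity>")
      case True
      have *: "epowr x a \<noteq> 0" "epowr y a \<noteq> 0"
        using nz a by (auto simp: epowr_def enn2real_eq_0_iff)
      have "x * y = \<infinity>" using True nz by (auto simp: ennreal_mult_eq_top_iff)
      moreover have "epowr x a * epowr y a = \<infinity>"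
        using True * a by (auto simp: ennreal_mult_eq_top_iff epowr_top[unfolded infinity_ennreal_def])
      ultimately show ?thesis using a by (simp add: epowr_top[unfolded infinity_ennreal_def])
    next
      case False
      then obtain r s where "x = ennreal r" "y = ennreal s" "0 < r" "0 < s"
        using nz by (cases x; cases y) (auto simp: less_le)
      then show ?thesis
        by (simp add: epowr_ennreal_pos powr_mult flip: ennreal_mult)
    qed
  qed
qed (simp add: epowr_def)

lemma epowr_epowr:
  assumes "0 < a" shows "epowr (epowr x a) b = epowr x (a * b)"
proof (cases x)
  case (real r)
  show ?thesis
  proof (cases "r = 0")
    case True
    then show ?thesis using real assms by (auto simp: epowr_def zero_less_mult_iff)
  next
    case False
    then show ?thesis using real assms by (simp add: epowr_ennreal_pos powr_powr less_le)
  qed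
qed (use assms in \<open>auto simp: epowr_def zero_less_mult_iff\<close>)

lemma epowr_eq_0_iff: "0 < a \<Longrightarrow> epowr x a = 0 \<longleftrightarrow> x = 0"
  by (auto simp: epowr_def enn2real_eq_0_iff)

lemma mult_epowr_diff:
  assumes "1 < a" shows "x * epowr x (a - 1) = epowr x a"
proof (cases x)
  case (real r)
  then show ?thesis using assms
    by (cases "r = 0") (simp_all add: epowr_zero epowr_ennreal powr_diff flip: ennreal_mult)
qed (use assms in \<open>auto simp: epowr_def\<close>)

lemma measurable_epowr [measurable (raw)]:
  assumes [measurable]: "f \<in> borel_measurable M"
  shows "(\<lambda>x. epowr (f x) a) \<in> borel_measurable M"
  unfolding epowr_def by measurable

lemma sigma_finite_lebesgue: "sigma_finite_measure (lebesgue :: 'a::euclidean_space measure)"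
proof
  obtain A :: "'a set set" where A: "countable A" "A \<subseteq> sets lborel" "\<Union>A = space lborel"
      "\<forall>a\<in>A. emeasure lborel a \<noteq> \<infinity>"
    using lborel.sigma_finite_countable by blast
  show "\<exists>A :: 'a set set. countable A \<and> A \<subseteq> sets lebesgue \<and> \<Union>A = space lebesgue \<and>
      (\<forall>a\<in>A. emeasure lebesgue a \<noteq> \<infinity>)"
  proof (intro exI[of _ A] conjI ballI)
    show "A \<subseteq> sets lebesgue" using A(2) by auto
    show "emeasure lebesgue a \<noteq> \<infinity>" if "a \<in> A" for a
      using that A(2,4) by auto
  qed (use A in auto)
qed

text \<open>
  The indicator of \<open>{t. t < y}\<close> is jointly measurable in \<open>t\<close> and \<open>y\<close>, so that Tonelli's theorem turns
  the integral of a power into an integral over the measures of level sets.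
\<close>

lemma layer_cake_epowr:
  assumes s: "0 < s"
  shows "epowr y s =
    (\<integral>\<^sup>+t. indicator {0<..} t * ennreal (s * t powr (s - 1))
        * indicator {t. ennreal t < y} t \<partial>lborel)"
    (is "_ = ?I y")
proof -
  have meas: "(\<lambda>t. indicator {0<..} t * ennreal (s * t powr (s - 1))) \<in> borel_measurable lborel"
    by measurable
  have fin: "?I (ennreal c) = ennreal (c powr s)" if c: "0 \<le> c" for c
  proof -
    have hi: "((\<lambda>t. s * t powr (s - 1)) has_integral c powr s) {0..c}"
      using has_integral_mult_right[OF has_integral_powr_from_0[of "s - 1" c], of s] s c by simp
    have "?I (ennreal c) = (\<integral>\<^sup>+t. ennreal (s * t powr (s - 1)) * indicator {0..c} t \<partial>lborel)"
    proof (rule nn_integral_cong_AE)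
      show "AE t in lborel. indicator {0<..} t * ennreal (s * t powr (s - 1))
          * indicator {t. ennreal t < ennreal c} t =
        ennreal (s * t powr (s - 1)) * indicator {0..c} t"
        using AE_lborel_singleton[of 0] AE_lborel_singleton[of c]
        by eventually_elim (auto simp: indicator_def ennreal_less_iff)
    qed
    also have "\<dots> = ennreal (c powr s)"
      using hi s by (intro nn_integral_has_integral_lebesgue') auto
    finally show ?thesis .
  qed
  show ?thesis
  proof (cases y)
    case (real c)
    then show ?thesis using fin s by (simp add: epowr_ennreal)
  next
    case top
    have *: "ennreal n \<le> ?I y" if "0 \<le> n" for n
    proof -
      have "ennreal n = ?I (ennreal (n powr (1 / s)))"
        using that s by (subst fin) (auto simp: powr_powr)
      also have "\<dots> \<le> ?I y"
        using top by (intro nn_integral_mono) (auto simp: indicator_def)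
      finally show ?thesis .
    qed
    have "?I y = \<infinity>"
    proof (rule ccontr)
      assume "?I y \<noteq> \<infinity>"
      then obtain r where "?I y = ennreal r" "0 \<le> r" by (cases "?I y") auto
      with *[of "r + 1"] show False by simp
    qed
    then show ?thesis using top s by (simp add: epowr_def)
  qed
qed

section \<open>Maximal functions over laminar families\<close>

text \<open>
  The only geometric property of dyadic cubes that the maximal theorem needs.
\<close>

definition laminar :: "'a set set \<Rightarrow> bool"
  where "laminar D \<longleftrightarrow> (\<forall>P\<in>D. \<forall>Q\<in>D. P \<subseteq> Q \<or> Q \<subseteq> P \<or> P \<inter> Q = {})"

lemma laminar_subset: "laminar D \<Longrightarrow> F \<subseteq> D \<Longrightarrow> laminar F"
  unfolding laminar_def by blast

text \<open>
  The supremum of \<open>a Q\<close> over the members \<open>Q\<close> containing the point. The set function \<open>a\<close> is arbitrary,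
  so that one operator serves for ordinary, fractional and weighted means.
\<close>

definition family_maximal :: "'a set set \<Rightarrow> ('a set \<Rightarrow> ennreal) \<Rightarrow> 'a \<Rightarrow> ennreal"
  where "family_maximal D a x = (SUP Q\<in>D. a Q * indicator Q x)"

definition mean :: "'a measure \<Rightarrow> ('a \<Rightarrow> ennreal) \<Rightarrow> 'a set \<Rightarrow> ennreal"
  where "mean M g Q = (\<integral>\<^sup>+x\<in>Q. g x \<partial>M) / emeasure M Q"

definition fractional_mean :: "real \<Rightarrow> 'a measure \<Rightarrow> ('a \<Rightarrow> ennreal) \<Rightarrow> 'a set \<Rightarrow> ennreal"
  where "fractional_mean c M h Q = ennreal (measure M Q powr (- c)) * (\<integral>\<^sup>+x\<in>Q. h x \<partial>M)"

lemma family_maximal_upper: "Q \<in> D \<Longrightarrow> x \<in> Q \<Longrightarrow> a Q \<le> family_maximal D a x"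
  unfolding family_maximal_def by (rule SUP_upper2[of Q]) auto

lemma family_maximal_least: "(\<And>Q. Q \<in> D \<Longrightarrow> x \<in> Q \<Longrightarrow> a Q \<le> c) \<Longrightarrow> family_maximal D a x \<le> c"
  unfolding family_maximal_def by (rule SUP_least) (auto simp: indicator_def)

lemma less_family_maximal_iff: "t < family_maximal D a x \<longleftrightarrow> (\<exists>Q\<in>D. x \<in> Q \<and> t < a Q)"
  unfolding family_maximal_def less_SUP_iff by (auto simp: indicator_def)

lemma measurable_family_maximal [measurable]:
  assumes "countable D" "D \<subseteq> sets M"
  shows "family_maximal D a \<in> borel_measurable M"
proof -
  have "(\<lambda>x. SUP Q\<in>D. a Q * indicator Q x) \<in> borel_measurable M"
    using assms by (intro borel_measurable_SUP borel_measurable_times_ennreal borel_measurable_indicator) auto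
  then show ?thesis by (simp add: family_maximal_def[abs_def])
qed

text \<open>
  The inclusion-maximal members of a finite laminar family are pairwise disjoint and cover its union,
  so the bounds for single members add up. They do the work of a covering lemma, without loss of a
  constant.
\<close>

lemma finite_laminar_union_le:
  assumes "finite F" "laminar F" "F \<subseteq> sets M" and [measurable]: "g \<in> borel_measurable M"
    and le: "\<And>Q. Q \<in> F \<Longrightarrow> t * emeasure M Q \<le> (\<integral>\<^sup>+x\<in>Q. g x \<partial>M)"
  shows "t * emeasure M (\<Union>F) \<le> (\<integral>\<^sup>+x\<in>\<Union>F. g x \<partial>M)"
proof -
  define G where "G = {Q\<in>F. \<forall>P\<in>F. Q \<subseteq> P \<longrightarrow> P = Q}"
  have G: "G \<subseteq> F" "finite G" using \<open>finite F\<close> by (auto simp: G_def)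
  have un: "\<Union>F = \<Union>G"
  proof -
    have "\<exists>P\<in>G. Q \<subseteq> P" if Q: "Q \<in> F" for Q
    proof -
      obtain P where "P \<in> F" "Q \<subseteq> P" "\<forall>b\<in>F. P \<subseteq> b \<longrightarrow> P = b"
        using finite_has_maximal2[OF \<open>finite F\<close> Q] by blast
      then show ?thesis by (intro bexI[of _ P]) (auto simp: G_def)
    qed
    then show ?thesis using G(1) by blast
  qed
  have disj: "disjoint_family_on id G"
    unfolding disjoint_family_on_def
  proof (intro ballI impI)
    fix P Q assume PQ: "P \<in> G" "Q \<in> G" "P \<noteq> Q"
    then have "P \<in> F" "Q \<in> F" "\<not> P \<subseteq> Q" "\<not> Q \<subseteq> P" by (auto simp: G_def)
    then show "id P \<inter> id Q = {}" using \<open>laminar F\<close> by (auto simp: laminar_def)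
  qed
  have "t * emeasure M (\<Union>G) = (\<Sum>Q\<in>G. t * emeasure M Q)"
    using sum_emeasure[of id G M] disj G assms(3) by (auto simp: sum_distrib_left[symmetric])
  also have "\<dots> \<le> (\<Sum>Q\<in>G. emeasure (density M g) Q)"
  proof (rule sum_mono)
    fix Q assume "Q \<in> G"
    then have "Q \<in> F" "Q \<in> sets M" using G assms(3) by auto
    then show "t * emeasure M Q \<le> emeasure (density M g) Q"
      using le[of Q] by (simp add: emeasure_density)
  qed
  also have "\<dots> = emeasure (density M g) (\<Union>G)"
    using sum_emeasure[of id G "density M g"] disj G assms(3) by auto
  also have "\<dots> = (\<integral>\<^sup>+x\<in>\<Union>G. g x \<partial>M)"
    using G assms(3) by (intro emeasure_density) (auto intro!: sets.finite_Union)
  finally show ?thesis by (simp add: un)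
qed

lemma countable_laminar_union_le:
  assumes "countable F" "laminar F" "F \<subseteq> sets M" and [measurable]: "g \<in> borel_measurable M"
    and le: "\<And>Q. Q \<in> F \<Longrightarrow> t * emeasure M Q \<le> (\<integral>\<^sup>+x\<in>Q. g x \<partial>M)"
  shows "t * emeasure M (\<Union>F) \<le> (\<integral>\<^sup>+x. g x \<partial>M)"
proof (cases "F = {}")
  case False
  define A where "A n = (from_nat_into F) ` {..n::nat}" for n
  have A: "A n \<subseteq> F" "finite (A n)" for n
    using from_nat_into[OF False] by (auto simp: A_def)
  have un: "\<Union>F = (\<Union>n. \<Union>(A n))"
    using from_nat_into_surj[OF \<open>countable F\<close>] A(1) by (fastforce simp: A_def)
  have "emeasure M (\<Union>F) = (SUP n. emeasure M (\<Union>(A n)))"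
    unfolding un
  proof (rule SUP_emeasure_incseq[symmetric])
    show "range (\<lambda>n. \<Union> (A n)) \<subseteq> sets M" using A assms(3) by (auto intro!: sets.finite_Union)
    show "incseq (\<lambda>n. \<Union> (A n))" by (force simp: incseq_def A_def)
  qed
  then have "t * emeasure M (\<Union>F) = (SUP n. t * emeasure M (\<Union>(A n)))"
    by (simp add: SUP_mult_left_ennreal)
  also have "\<dots> \<le> (\<integral>\<^sup>+x. g x \<partial>M)"
  proof (rule SUP_least)
    fix n
    have "t * emeasure M (\<Union>(A n)) \<le> (\<integral>\<^sup>+x\<in>\<Union>(A n). g x \<partial>M)"
      using A(1)[of n] A(2)[of n] assms(3) subsetD[OF A(1), THEN le, of _ n]
      by (intro finite_laminar_union_le laminar_subset[OF assms(2)]) auto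
    also have "\<dots> \<le> (\<integral>\<^sup>+x. g x \<partial>M)"
      by (intro nn_integral_mono) (auto simp: indicator_def)
    finally show "t * emeasure M (\<Union>(A n)) \<le> (\<integral>\<^sup>+x. g x \<partial>M)" .
  qed
  finally show ?thesis .
qed auto

text \<open>
  On a member with mean above \<open>t\<close>, the part of \<open>g\<close> not exceeding \<open>t / 2\<close> accounts for at most half
  of \<open>t * emeasure M Q\<close>, so the large part of \<open>g\<close> alone has integral at least half of it. Keeping only
  the large part of \<open>g\<close> is what makes the strong type bound follow by integration over \<open>t\<close>.
\<close>

lemma maximal_weak_type:
  assumes D: "countable D" "laminar D" "D \<subseteq> sets M" "\<And>Q. Q \<in> D \<Longrightarrow> emeasure M Q < \<infinity>"
    and [measurable]: "g \<in> borel_measurable M"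
  shows "ennreal t * emeasure M {x\<in>space M. ennreal t < family_maximal D (mean M g) x}
    \<le> 2 * (\<integral>\<^sup>+x. g x * indicator {x. ennreal t < 2 * g x} x \<partial>M)"
proof -
  define F where "F = {Q\<in>D. ennreal t < mean M g Q}"
  have "{x\<in>space M. ennreal t < family_maximal D (mean M g) x} = \<Union>F"
    using subsetD[OF D(3), THEN sets.sets_into_space] by (auto simp: F_def less_family_maximal_iff)
  moreover have "ennreal t * emeasure M (\<Union>F)
      \<le> (\<integral>\<^sup>+x. 2 * (g x * indicator {x. ennreal t < 2 * g x} x) \<partial>M)"
  proof (rule countable_laminar_union_le)
    show "countable F" using D(1) by (simp add: F_def)
    show "laminar F" using D(2) by (rule laminar_subset) (auto simp: F_def)
    show "F \<subseteq> sets M" using D(3) by (auto simp: F_def)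
    show k [measurable]: "(\<lambda>x. 2
        * (g x * indicator {x. ennreal t < 2 * g x} x)) \<in> borel_measurable M"
      unfolding indicator_def by measurable
    fix Q assume "Q \<in> F"
    then have Q: "Q \<in> D" "ennreal t < mean M g Q" by (auto simp: F_def)
    have [measurable]: "Q \<in> sets M" using Q D(3) by auto
    have fin: "emeasure M Q < \<infinity>" using D(4) Q by auto
    have 1: "ennreal t * emeasure M Q \<le> (\<integral>\<^sup>+x\<in>Q. g x \<partial>M)"
    proof (cases "emeasure M Q = 0")
      case False
      then have "ennreal t * emeasure M Q \<le> mean M g Q * emeasure M Q"
        using Q by (intro mult_right_mono) auto
      also have "\<dots> = (\<integral>\<^sup>+x\<in>Q. g x \<partial>M)"
        using False fin by (simp add: mean_def ennreal_divide_times ennreal_mult_divide_eq)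
      finally show ?thesis .
    qed simp
    have "ennreal t * emeasure M Q + ennreal t * emeasure M Q \<le> 2 * (\<integral>\<^sup>+x\<in>Q. g x \<partial>M)"
      using add_mono[OF 1 1] by (simp add: mult_2)
    also have "\<dots> = (\<integral>\<^sup>+x. 2 * (g x * indicator Q x) \<partial>M)"
      by (simp add: nn_integral_cmult)
    also have "\<dots> \<le> (\<integral>\<^sup>+x. ennreal t * indicator Q x + 2
        * (g x * indicator {x. ennreal t < 2 * g x} x) * indicator Q x \<partial>M)"
      by (intro nn_integral_mono) (auto simp: indicator_def)
    also have "\<dots> = ennreal t * emeasure M Q + (\<integral>\<^sup>+x\<in>Q. 2
        * (g x * indicator {x. ennreal t < 2 * g x} x) \<partial>M)"
      by (subst nn_integral_add) (auto simp: nn_integral_cmult_indicator intro!: borel_measurable_times_ennreal k)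
    finally show "ennreal t * emeasure M Q
        \<le> (\<integral>\<^sup>+x\<in>Q. 2 * (g x * indicator {x. ennreal t < 2 * g x} x) \<partial>M)"
      using fin by (subst (asm) ennreal_add_left_cancel_le) (auto simp: ennreal_mult_eq_top_iff)
  qed
  moreover have "(\<integral>\<^sup>+x. 2 * (g x * indicator {x. ennreal t < 2 * g x} x) \<partial>M)
      = 2 * (\<integral>\<^sup>+x. g x * indicator {x. ennreal t < 2 * g x} x \<partial>M)"
    by (rule nn_integral_cmult) (simp add: indicator_def)
  ultimately show ?thesis by simp
qed

definition doob_const :: "real \<Rightarrow> real"
  where "doob_const r = 2 powr r * (r / (r - 1))"

lemma doob_const_pos: "1 < r \<Longrightarrow> 0 < doob_const r"
  by (simp add: doob_const_def)

text \<open>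
  Marcinkiewicz interpolation between the weak type bound and the trivial bound at \<open>\<infinity>\<close>: by the layer
  cake formula and Tonelli, the integral over \<open>t\<close> of \<open>r * t powr (r - 1)\<close> times the weak type bound is
  a layer cake integral of \<open>2 * g\<close> with exponent \<open>r - 1\<close>. The constant does not depend on the measure.
\<close>

lemma maximal_strong_type:
  assumes sf: "sigma_finite_measure M"
    and D: "countable D" "laminar D" "D \<subseteq> sets M" "\<And>Q. Q \<in> D \<Longrightarrow> emeasure M Q < \<infinity>"
    and [measurable]: "g \<in> borel_measurable M" and r: "1 < r"
  shows "(\<integral>\<^sup>+x. epowr (family_maximal D (mean M g) x) r \<partial>M)
      \<le> ennreal (doob_const r) * (\<integral>\<^sup>+x. epowr (g x) r \<partial>M)"
proof -
  interpret M: sigma_finite_measure M by (rule sf)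
  interpret P: pair_sigma_finite lborel M ..
  define H where "H = family_maximal D (mean M g)"
  have [measurable]: "H \<in> borel_measurable M" unfolding H_def using D by measurable
  let ?w = "\<lambda>s t::real. indicator {0<..} t * ennreal (s * t powr (s - 1))"
  have w [measurable]: "?w s \<in> borel_measurable lborel" for s by measurable
  have "(\<integral>\<^sup>+x. epowr (H x) r \<partial>M)
      = (\<integral>\<^sup>+x. (\<integral>\<^sup>+t. ?w r t * indicator {t. ennreal t < H x} t \<partial>lborel) \<partial>M)"
    using r by (subst layer_cake_epowr[of r]) auto
  also have "\<dots> = (\<integral>\<^sup>+t. (\<integral>\<^sup>+x. ?w r t * indicator {t. ennreal t < H x} t \<partial>M) \<partial>lborel)"
    by (rule P.Fubini') (simp add: indicator_def)
  also have "\<dots> = (\<integral>\<^sup>+t. ?w r t * emeasure M {x\<in>space M. ennreal t < H x} \<partial>lborel)"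
  proof (rule nn_integral_cong)
    fix t :: real
    have "(\<integral>\<^sup>+x. ?w r t * indicator {t. ennreal t < H x} t \<partial>M)
        = (\<integral>\<^sup>+x. ?w r t * indicator {x\<in>space M. ennreal t < H x} x \<partial>M)"
      by (intro nn_integral_cong) (auto simp: indicator_def)
    also have "\<dots> = ?w r t * emeasure M {x\<in>space M. ennreal t < H x}"
      by (subst nn_integral_cmult) auto
    finally show "(\<integral>\<^sup>+x. ?w r t * indicator {t. ennreal t < H x} t \<partial>M) = \<dots>" .
  qed
  also have "\<dots> \<le> (\<integral>\<^sup>+t. (\<integral>\<^sup>+x. ennreal (r / (r - 1)) * (2 * g x)
      * (?w (r - 1) t * indicator {t. ennreal t < 2 * g x} t) \<partial>M) \<partial>lborel)"
  proof (rule nn_integral_mono)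
    fix t :: real
    show "?w r t * emeasure M {x\<in>space M. ennreal t < H x}
        \<le> (\<integral>\<^sup>+x. ennreal (r / (r - 1)) * (2 * g x)
        * (?w (r - 1) t * indicator {t. ennreal t < 2 * g x} t) \<partial>M)"
    proof (cases "0 < t")
      case True
      have eq: "ennreal (r * t powr (r - 1))
          = ennreal (r / (r - 1)) * ennreal ((r - 1) * t powr (r - 2)) * ennreal t"
      proof -
        have "t powr (r - 1) = t powr (r - 2) * t"
          using powr_add[of t "r - 2" 1] True by simp
        then show ?thesis using True r by (simp flip: ennreal_mult)
      qed
      have "?w r t * emeasure M {x\<in>space M. ennreal t < H x}
        = ennreal (r / (r - 1)) * ennreal ((r - 1) * t powr (r - 2))
            * (ennreal t * emeasure M {x\<in>space M. ennreal t < H x})"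
        using True by (simp add: eq mult.assoc)
      also have "\<dots> \<le> ennreal (r / (r - 1)) * ennreal ((r - 1) * t powr (r - 2)) *
          (2 * (\<integral>\<^sup>+x. g x * indicator {x. ennreal t < 2 * g x} x \<partial>M))"
        using maximal_weak_type[OF D, of g t] by (intro mult_left_mono) (auto simp: H_def)
      also have "\<dots> = (\<integral>\<^sup>+x. ennreal (r / (r - 1)) * ennreal ((r - 1) * t powr (r - 2)) * 2
          * (g x * indicator {x. ennreal t < 2 * g x} x) \<partial>M)"
        by (subst nn_integral_cmult) (auto simp: indicator_def mult.assoc)
      also have "\<dots> = (\<integral>\<^sup>+x. ennreal (r / (r - 1)) * (2 * g x)
          * (?w (r - 1) t * indicator {t. ennreal t < 2 * g x} t) \<partial>M)"
        using True by (intro nn_integral_cong) (auto simp: indicator_def mult_ac)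
      finally show ?thesis .
    qed simp
  qed
  also have "\<dots> = (\<integral>\<^sup>+x. (\<integral>\<^sup>+t. ennreal (r / (r - 1)) * (2 * g x)
      * (?w (r - 1) t * indicator {t. ennreal t < 2 * g x} t) \<partial>lborel) \<partial>M)"
    by (rule P.Fubini'[symmetric]) (simp add: indicator_def)
  also have "\<dots> = (\<integral>\<^sup>+x. ennreal (doob_const r) * epowr (g x) r \<partial>M)"
  proof (rule nn_integral_cong)
    fix x
    have "(\<integral>\<^sup>+t. ennreal (r / (r - 1)) * (2 * g x)
        * (?w (r - 1) t * indicator {t. ennreal t < 2 * g x} t) \<partial>lborel)
      = ennreal (r / (r - 1)) * (2 * g x)
          * (\<integral>\<^sup>+t. (?w (r - 1) t * indicator {t. ennreal t < 2 * g x} t) \<partial>lborel)"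
      by (rule nn_integral_cmult) (simp add: indicator_def)
    also have "\<dots> = ennreal (r / (r - 1)) * ((2 * g x) * epowr (2 * g x) (r - 1))"
      using layer_cake_epowr[of "r - 1" "2 * g x"] r by (simp add: mult_ac)
    also have "\<dots> = ennreal (r / (r - 1)) * (epowr 2 r * epowr (g x) r)"
      using r by (subst mult_epowr_diff) (simp_all add: epowr_mult)
    also have "epowr 2 r = ennreal (2 powr r)"
      using epowr_ennreal_pos[of 2 r] by simp
    also have "ennreal (r / (r - 1)) * (ennreal (2 powr r) * epowr (g x) r)
        = ennreal (doob_const r) * epowr (g x) r"
    proof -
      have "ennreal (doob_const r) = ennreal (r / (r - 1)) * ennreal (2 powr r)"
        using r by (simp add: doob_const_def mult.commute flip: ennreal_mult)
      then show ?thesis by (simp only: mult.assoc)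
    qed
    finally show "(\<integral>\<^sup>+t. ennreal (r / (r - 1)) * (2 * g x)
        * (?w (r - 1) t * indicator {t. ennreal t < 2 * g x} t) \<partial>lborel)
        = ennreal (doob_const r) * epowr (g x) r" .
  qed
  also have "\<dots> = ennreal (doob_const r) * (\<integral>\<^sup>+x. epowr (g x) r \<partial>M)"
    by (rule nn_integral_cmult) measurable
  finally show ?thesis by (simp add: H_def)
qed

section \<open>The weighted estimate on a laminar family\<close>

text \<open>
  Pointwise form of Hoelder's inequality for \<open>y = g * s\<close> with \<open>s = v powr (- p')\<close>: either \<open>g \<le> \<tau>\<close>, or
  \<open>g \<le> \<tau> * (g / \<tau>) powr p\<close>, and \<open>g powr p * s = (v * y) powr p\<close>. Integrating and then choosing \<open>\<tau>\<close>
  gives Hoelder's inequality up to a factor \<open>2\<close>.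
\<close>

lemma young_split:
  assumes "0 < \<tau>" "0 < s" "0 < v" "1 < p" and s: "s = v powr (- conj_exponent p)"
  shows "(y::ennreal) \<le> ennreal (\<tau> * s) + ennreal (\<tau> powr (1 - p)) * epowr (ennreal v * y) p"
proof (cases y)
  case (real r)
  show ?thesis
  proof (cases "r \<le> \<tau> * s")
    case True
    then have "y \<le> ennreal (\<tau> * s)" using real by (simp add: ennreal_leI)
    then show ?thesis by (rule order_trans) simp
  next
    case False
    then have r: "0 < r" "\<tau> * s < r" using assms mult_pos_pos[of \<tau> s] by linarith+
    have "\<tau> powr (p - 1) \<le> (r / s) powr (p - 1)"
      using r assms by (intro powr_mono2) (auto simp: field_simps)
    also have "\<dots> = r powr (p - 1) * inverse (s powr (p - 1))"
      using r \<open>0 < s\<close> by (simp add: powr_divide field_simps)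
    also have "s powr (p - 1) = v powr (- p)"
      using assms by (simp add: powr_powr conj_exponent_def)
    also have "inverse (v powr (- p)) = v powr p" by (simp add: powr_minus)
    finally have "\<tau> powr (p - 1) * r \<le> r powr (p - 1) * v powr p * r"
      using r by (intro mult_right_mono) auto
    also have "\<dots> = (v * r) powr p"
      using r assms by (simp add: powr_mult powr_diff)
    finally have "r \<le> \<tau> powr (1 - p) * (v * r) powr p"
      using assms by (simp add: powr_diff field_simps)
    then have "y \<le> ennreal (\<tau> powr (1 - p)) * epowr (ennreal v * y) p"
      using real r assms by (simp add: epowr_ennreal_pos ennreal_leI flip: ennreal_mult)
    then show ?thesis by (rule order_trans) simp
  qed
next
  case top
  have "ennreal v * top = top" using assms by (simp add: ennreal_mult_top)
  then show ?thesis using top assms by (simp add: epowr_def ennreal_mult_top)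
qed

lemma set_nn_integral_nonzero:
  fixes f :: "'a \<Rightarrow> real"
  assumes f: "\<And>x. 0 < f x" and [measurable]: "f \<in> borel_measurable M"
    and Q [measurable]: "Q \<in> sets M" and "emeasure M Q \<noteq> 0"
  shows "(\<integral>\<^sup>+x\<in>Q. ennreal (f x) \<partial>M) \<noteq> 0"
proof
  assume "(\<integral>\<^sup>+x\<in>Q. ennreal (f x) \<partial>M) = 0"
  then have "AE x in M. ennreal (f x) * indicator Q x = 0"
      by (subst (asm) nn_integral_0_iff_AE) auto
  then have "AE x in M. x \<notin> Q"
    by eventually_elim (use f in \<open>auto simp: indicator_def ennreal_eq_0_iff not_le[symmetric] split: if_splits\<close>)
  then have "emeasure M Q = 0"
    by (subst (asm) AE_iff_measurable[OF Q]) (use sets.sets_into_space[OF Q] in auto)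
  then show False using assms(4) by simp
qed

text \<open>
  The hypothesis \<open>Muckenhoupt\<close> is the \<open>A\<^bsub>p,q\<^esub>\<close> condition with the means multiplied out. The function
  \<open>v\<close> is a weight that has been made positive and finite everywhere, which changes a member of
  the class on a null set only.
\<close>

locale weighted_laminar =
  fixes M :: "'a measure" and D :: "'a set set" and v :: "'a \<Rightarrow> real" and p q K :: real
  assumes sf: "sigma_finite_measure M"
    and D: "countable D" "laminar D" "D \<subseteq> sets M"
    and D_pos: "\<And>Q. Q \<in> D \<Longrightarrow> 0 < measure M Q"
    and v_meas [measurable]: "v \<in> borel_measurable M" and v_pos: "\<And>x. 0 < v x"
    and p: "1 < p" and pq: "p \<le> q"
    and K: "0 < K"
    and Muckenhoupt: "\<And>Q. Q \<in> D \<Longrightarrow>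
      (\<integral>\<^sup>+x\<in>Q. ennreal (v x powr q) \<partial>M) *
      epowr (\<integral>\<^sup>+x\<in>Q. ennreal (v x powr (- conj_exponent p)) \<partial>M) (q / conj_exponent p)
      \<le> ennreal (K * measure M Q powr (1 + q / conj_exponent p))"
begin

abbreviation "p' \<equiv> conj_exponent p"

text \<open>
  With \<open>1 / q = 1 / p - \<alpha> / n\<close> the number \<open>\<gamma>\<close> is \<open>1 - \<alpha> / n\<close>, the power of \<open>|Q|\<close> in the fractional
  maximal operator, and \<open>\<theta>\<close> is the exponent of the weight constant. The densities \<open>u\<close> and \<open>s\<close> are the
  two weights of the \<open>A\<^bsub>p,q\<^esub>\<close> condition, with measures \<open>mu\<close> and \<open>ms\<close>.
\<close>

definition "\<gamma> = 1 / p' + 1 / q"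
definition "\<theta> = p' / q * \<gamma>"
definition "u x = v x powr q"
definition "s x = v x powr (- p')"
definition "mu = density M (\<lambda>x. ennreal (u x))"
definition "ms = density M (\<lambda>x. ennreal (s x))"

lemma p': "1 < p'" "1 / p + 1 / p' = 1"
  using p conj_exponent_iff[of p p'] by (auto simp: conj_exponent_def field_simps)

lemma q: "1 < q" using p pq by simp

lemma exps: "0 < \<gamma>" "0 < \<theta>" "\<theta> * q = 1 + p' / q" "1 < \<theta> * q" "\<theta> * (q / p') = \<gamma>"
  using p' q by (auto simp: \<gamma>_def \<theta>_def divide_simps algebra_simps add_pos_pos)

lemma [measurable]: "u \<in> borel_measurable M" "s \<in> borel_measurable M"
  unfolding u_def[abs_def] s_def[abs_def] by measurable

lemma us_pos: "0 < u x" "0 < s x"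
  using v_pos[of x] by (auto simp: u_def s_def)

lemma D_sets: "Q \<in> D \<Longrightarrow> Q \<in> sets M" using D(3) by auto

lemma D_fin: "Q \<in> D \<Longrightarrow> emeasure M Q = ennreal (measure M Q)"
  using D_pos[of Q] by (metis emeasure_eq_ennreal_measure enn2real_top less_irrefl measure_def)

text \<open>
  Both masses are positive because the densities are, so finiteness of the product in the
  \<open>A\<^bsub>p,q\<^esub>\<close> condition makes both of them finite.
\<close>

lemma weight_masses:
  assumes Q: "Q \<in> D"
  obtains a b where "0 < a" "0 < b" "emeasure mu Q = ennreal a" "emeasure ms Q = ennreal b"
    "a * b powr (q / p') \<le> K * measure M Q powr (1 + q / p')"
proof -
  have [measurable]: "Q \<in> sets M" using Q by (rule D_sets)
  have "emeasure M Q \<noteq> 0" using D_pos[OF Q] by (auto simp: measure_def)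
  note pos = set_nn_integral_nonzero[OF _ _ \<open>Q \<in> sets M\<close> this]
  have "emeasure mu Q \<noteq> 0" "emeasure ms Q \<noteq> 0"
    using pos[of u] pos[of s] us_pos by (auto simp: mu_def ms_def emeasure_density)
  moreover have cond: "emeasure mu Q * epowr (emeasure ms Q) (q / p')
      \<le> ennreal (K * measure M Q powr (1 + q / p'))"
    using Muckenhoupt[OF Q] by (simp add: mu_def ms_def emeasure_density u_def s_def)
  moreover have qp: "0 < q / p'" using q p' by simp
  ultimately have "emeasure mu Q \<noteq> \<infinity>" "emeasure ms Q \<noteq> \<infinity>"
    by (auto simp: ennreal_top_mult ennreal_mult_top epowr_eq_0_iff epowr_top[unfolded infinity_ennreal_def] top_unique)
  then obtain a b where ab: "emeasure mu Q = ennreal a" "emeasure ms Q = ennreal b" "0 \<le> a" "0 \<le> b"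
    by (cases "emeasure mu Q"; cases "emeasure ms Q") auto
  then have "0 < a" "0 < b" using \<open>emeasure mu Q \<noteq> 0\<close> \<open>emeasure ms Q \<noteq> 0\<close> by (auto simp: less_le)
  moreover have "a * b powr (q / p') \<le> K * measure M Q powr (1 + q / p')"
    using cond ab \<open>0 < b\<close> K by (simp add: epowr_ennreal_pos flip: ennreal_mult)
  ultimately show ?thesis using that ab by blast
qed

context
  fixes h :: "'a \<Rightarrow> ennreal" and j :: real
  assumes h [measurable]: "h \<in> borel_measurable M" and j: "0 < j"
    and norm: "(\<integral>\<^sup>+x. epowr (ennreal (v x) * h x) p \<partial>M) = ennreal j"
begin

text \<open>
  The function \<open>g\<close> is \<open>h / s\<close>. It turns \<open>h dx\<close> into \<open>g ms\<close> and the norm of \<open>v * h\<close> into the \<open>p\<close>-norm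
  of \<open>g\<close> for \<open>ms\<close>. The function \<open>N\<close> is the fractional maximal function of \<open>g\<close> for the measure \<open>ms\<close>.
\<close>

definition "g x = h x * ennreal (v x powr p')"

definition "N = family_maximal D (\<lambda>Q. ennreal (measure ms Q powr (- \<gamma>)) * (\<integral>\<^sup>+x\<in>Q. h x \<partial>M))"

lemma g_meas [measurable]: "g \<in> borel_measurable M"
  unfolding g_def[abs_def] by measurable

lemma N_meas [measurable]: "N \<in> borel_measurable M"
  unfolding N_def using D by measurable

lemma g_s: "g x * ennreal (s x) = h x"
proof -
  have "v x powr p' * s x = 1" using v_pos[of x] by (simp add: s_def powr_minus)
  then have "ennreal (v x powr p') * ennreal (s x) = 1"
    using us_pos(2)[of x] by (simp flip: ennreal_mult)
  then show ?thesis by (simp add: g_def mult.assoc)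
qed

lemma g_norm: "(\<integral>\<^sup>+x. epowr (g x) p \<partial>ms) = ennreal j"
proof -
  have "(\<integral>\<^sup>+x. epowr (g x) p \<partial>ms) = (\<integral>\<^sup>+x. ennreal (s x) * epowr (g x) p \<partial>M)"
    by (simp add: ms_def nn_integral_density)
  also have "\<dots> = (\<integral>\<^sup>+x. epowr (ennreal (v x) * h x) p \<partial>M)"
  proof (rule nn_integral_cong)
    fix x
    have "p' * (p - 1) = p" using p by (simp add: conj_exponent_def)
    then have e: "p' * p - p' = p" by (simp add: algebra_simps)
    have "s x * (v x powr p') powr p = v x powr p"
      using v_pos[of x] e by (simp add: s_def powr_powr flip: powr_add)
    then have "ennreal (s x) * epowr (ennreal (v x powr p')) p = epowr (ennreal (v x)) p"
      using v_pos[of x] us_pos(2)[of x] by (simp add: epowr_ennreal_pos flip: ennreal_mult)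
    then show "ennreal (s x) * epowr (g x) p = epowr (ennreal (v x) * h x) p"
      using p by (simp add: g_def epowr_mult) (simp only: ac_simps)
  qed
  finally show ?thesis using norm by simp
qed

lemma holder:
  assumes Q: "Q \<in> D" and b: "0 < b" "emeasure ms Q = ennreal b"
  shows "(\<integral>\<^sup>+x\<in>Q. h x \<partial>M) \<le> ennreal (2 * b powr (1 / p') * j powr (1 / p))"
proof -
  have [measurable]: "Q \<in> sets M" using Q by (rule D_sets)
  \<comment> \<open>This \<open>\<tau>\<close> makes the two summands of the splitting equal.\<close>
  define \<tau> where "\<tau> = (j / b) powr (1 / p)"
  have \<tau>: "0 < \<tau>" using j b by (simp add: \<tau>_def)
  have "(\<integral>\<^sup>+x\<in>Q. h x \<partial>M) \<le> (\<integral>\<^sup>+x. ennreal \<tau>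
      * (ennreal (s x) * indicator Q x) + ennreal (\<tau> powr (1 - p))
      * epowr (ennreal (v x) * h x) p \<partial>M)"
  proof (rule nn_integral_mono)
    fix x show "h x * indicator Q x
        \<le> ennreal \<tau> * (ennreal (s x) * indicator Q x) + ennreal (\<tau> powr (1 - p))
        * epowr (ennreal (v x) * h x) p"
      using young_split[OF \<tau> us_pos(2)[of x] v_pos[of x] p s_def, of "h x"] \<tau> us_pos(2)[of x]
      by (auto simp: indicator_def ennreal_mult less_imp_le)
  qed
  also have "\<dots> = ennreal \<tau> * emeasure ms Q + ennreal (\<tau> powr (1 - p)) * ennreal j"
    by (simp add: nn_integral_add nn_integral_cmult norm ms_def emeasure_density)
  also have "\<dots> = ennreal (\<tau> * b + \<tau> powr (1 - p) * j)"
    using b \<tau> j by (simp flip: ennreal_mult ennreal_plus)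
  also have "\<tau> * b = b powr (1 / p') * j powr (1 / p)"
  proof -
    have "1 / p' = 1 - 1 / p" using p'(2) by simp
    then show ?thesis using b j unfolding \<tau>_def by (simp add: powr_divide powr_diff)
  qed
  also have "\<tau> powr (1 - p) * j = b powr (1 / p') * j powr (1 / p)"
  proof -
    have "1 / p' = 1 - 1 / p" using p'(2) by simp
    moreover have "1 / p * (1 - p) = 1 / p - 1" using p by (simp add: field_simps)
    ultimately show ?thesis using b j p unfolding \<tau>_def
        by (simp add: powr_divide powr_powr powr_diff)
  qed
  finally show ?thesis by (simp add: ac_simps)
qed

text \<open>
  With \<open>b = ms Q\<close> and \<open>i = (\<integral>\<^sub>Q h)\<close>, one has \<open>b powr (- \<gamma>) * i = b powr (1 / p - 1 / q) * (i / b)\<close>. The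
  portion \<open>(i / b) powr (1 - p / q)\<close> of the mean is estimated by Hoelder's inequality, which cancels
  the power of \<open>b\<close>, and the rest is a power of an ordinary mean for \<open>ms\<close>. Thus the fractional operator
  is dominated by the Hardy--Littlewood one of the same measure.
\<close>

lemma N_le: "N x \<le> ennreal (2 powr (1 - p / q) * j powr (1 / p - 1 / q))
    * epowr (family_maximal D (mean ms g) x) (p / q)"
  unfolding N_def
proof (rule family_maximal_least)
  fix Q assume Q: "Q \<in> D" "x \<in> Q"
  have [measurable]: "Q \<in> sets M" using Q D_sets by auto
  obtain a b where ab: "0 < a" "0 < b" "emeasure mu Q = ennreal a" "emeasure ms Q = ennreal b"
    using weight_masses[OF Q(1)] by metis
  obtain i where i: "(\<integral>\<^sup>+x\<in>Q. h x \<partial>M) = ennreal i" "0 \<le> i" "i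
      \<le> 2 * b powr (1 / p') * j powr (1 / p)"
    using holder[OF Q(1) ab(2,4)] by (cases "\<integral>\<^sup>+x\<in>Q. h x \<partial>M") (auto simp: top_unique)
  have "(\<integral>\<^sup>+x\<in>Q. g x \<partial>ms) = (\<integral>\<^sup>+x\<in>Q. h x \<partial>M)"
    unfolding ms_def by (subst nn_integral_density) (auto intro!: nn_integral_cong simp: g_s[symmetric] ac_simps)
  then have m: "mean ms g Q = ennreal (i / b)"
    using i ab by (simp add: mean_def divide_ennreal)
  have pq1: "0 \<le> 1 - p / q" "0 < p / q" using pq p by auto
  have real: "b powr (- \<gamma>) * i \<le> 2 powr (1 - p / q) * j powr (1 / p - 1 / q) * (i / b) powr (p / q)"
  proof (cases "i = 0")
    case False
    then have ib: "0 < i / b" using i ab by simp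
    have g1: "- \<gamma> + 1 = 1 / p - 1 / q" using p'(2) by (simp add: \<gamma>_def)
    have "b powr (- \<gamma> + 1) = b powr (- \<gamma>) * b"
      using powr_add[of b "- \<gamma>" 1] ab by simp
    then have "b powr (- \<gamma>) * i = b powr (- \<gamma> + 1) * (i / b)"
      using ab by simp
    also have "\<dots> = (i / b) powr (p / q) * (b powr (1 / p - 1 / q) * (i / b) powr (1 - p / q))"
    proof -
      have split: "(i / b) powr (p / q) * (i / b) powr (1 - p / q) = i / b"
        using ib i ab powr_add[of "i / b" "p / q" "1 - p / q"] by simp
      have "b powr (- \<gamma> + 1) * (i / b)
          = b powr (1 / p - 1 / q) * ((i / b) powr (p / q) * (i / b) powr (1 - p / q))"
        by (simp only: g1 split)
      then show ?thesis by (simp only: ac_simps)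
    qed
    also have "\<dots> \<le> (i / b) powr (p / q)
        * (b powr (1 / p - 1 / q) * (2 * (j / b) powr (1 / p)) powr (1 - p / q))"
    proof -
      have "i / b \<le> 2 * (b powr (1 / p') / b * j powr (1 / p))"
        using i ab by (simp add: field_simps)
      also have "b powr (1 / p') / b = b powr (- (1 / p))"
      proof -
        have e: "1 / p' = 1 + - (1 / p)" using p'(2) by simp
        show ?thesis unfolding e using ab by (subst powr_add) simp
      qed
      finally have "i / b \<le> 2 * (j / b) powr (1 / p)"
        using ab j by (simp add: powr_divide powr_minus field_simps)
      then show ?thesis using ib pq1 by (intro mult_left_mono powr_mono2) auto
    qed
    also have "(2 * (j / b) powr (1 / p)) powr (1 - p / q)
        = 2 powr (1 - p / q) * (j / b) powr (1 / p - 1 / q)"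
    proof -
      have "1 / p * (1 - p / q) = 1 / p - 1 / q" using p by (simp add: field_simps)
      then show ?thesis using ab j by (simp add: powr_mult powr_powr)
    qed
    also have "b powr (1 / p - 1 / q) * (2 powr (1 - p / q) * (j / b) powr (1 / p - 1 / q))
        = 2 powr (1 - p / q) * j powr (1 / p - 1 / q)"
      using ab j by (simp add: powr_divide)
    finally show ?thesis by (simp add: mult.commute)
  qed simp
  have "ennreal (measure ms Q powr (- \<gamma>)) * (\<integral>\<^sup>+x\<in>Q. h x \<partial>M) = ennreal (b powr (- \<gamma>) * i)"
    using i ab by (simp add: measure_def ennreal_mult)
  also have "\<dots> \<le> ennreal (2 powr (1 - p / q) * j powr (1 / p - 1 / q) * (i / b) powr (p / q))"
    by (rule ennreal_leI[OF real])
  also have "\<dots> = ennreal (2 powr (1 - p / q) * j powr (1 / p - 1 / q))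
      * epowr (mean ms g Q) (p / q)"
    using i ab pq1 by (simp add: m epowr_ennreal ennreal_mult)
  also have "\<dots> \<le> ennreal (2 powr (1 - p / q) * j powr (1 / p - 1 / q))
      * epowr (family_maximal D (mean ms g) x) (p / q)"
    using pq1 Q by (intro mult_left_mono epowr_mono family_maximal_upper) auto
  finally show "ennreal (measure ms Q powr (- \<gamma>)) * (\<integral>\<^sup>+x\<in>Q. h x \<partial>M) \<le> \<dots>" .
qed

lemma nn_integral_mu:
  assumes [measurable]: "f \<in> borel_measurable M"
  shows "(\<integral>\<^sup>+x. f x \<partial>mu) = (\<integral>\<^sup>+x. ennreal (u x) * f x \<partial>M)"
  by (simp add: mu_def nn_integral_density)

lemma sigma_finite_weights: "sigma_finite_measure mu" "sigma_finite_measure ms"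
  unfolding mu_def ms_def
  by (simp_all add: sigma_finite_measure.sigma_finite_iff_density_finite[OF sf])

lemma D_fin_weights: "Q \<in> D \<Longrightarrow> emeasure mu Q < \<infinity>" "Q \<in> D \<Longrightarrow> emeasure ms Q < \<infinity>"
  using weight_masses[of Q] by (metis ennreal_less_top infinity_ennreal_def)+

lemma N_norm: "(\<integral>\<^sup>+x. epowr (N x) q \<partial>ms) \<le> ennreal (2 powr (q - p) * doob_const p * j powr (q / p))"
proof -
  have pq1: "0 < p / q" using pq p by auto
  have sets_ms: "D \<subseteq> sets ms" using D by (simp add: ms_def)
  have [measurable]: "g \<in> borel_measurable ms" by (simp add: ms_def)
  have [measurable]: "family_maximal D (mean ms g) \<in> borel_measurable ms"
      using D sets_ms by measurable
  define c where "c = 2 powr (1 - p / q) * j powr (1 / p - 1 / q)"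
  have c: "0 < c" using j by (simp add: c_def)
  have "(\<integral>\<^sup>+x. epowr (N x) q \<partial>ms)
      \<le> (\<integral>\<^sup>+x. ennreal (c powr q) * epowr (family_maximal D (mean ms g) x) p \<partial>ms)"
  proof (rule nn_integral_mono)
    fix x
    have "epowr (N x) q \<le> epowr (ennreal c * epowr (family_maximal D (mean ms g) x) (p / q)) q"
      using q N_le[of x] by (intro epowr_mono) (auto simp: c_def)
    also have "\<dots> = ennreal (c powr q) * epowr (family_maximal D (mean ms g) x) p"
      using q pq1 c by (simp add: epowr_mult epowr_epowr epowr_ennreal_pos)
    finally show "epowr (N x) q \<le> ennreal (c powr q) * epowr (family_maximal D (mean ms g) x) p" .
  qed
  also have "\<dots> = ennreal (c powr q) * (\<integral>\<^sup>+x. epowr (family_maximal D (mean ms g) x) p \<partial>ms)"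
    by (rule nn_integral_cmult) measurable
  also have "\<dots> \<le> ennreal (c powr q) * (ennreal (doob_const p) * (\<integral>\<^sup>+x. epowr (g x) p \<partial>ms))"
    by (intro mult_left_mono maximal_strong_type sigma_finite_weights D sets_ms D_fin_weights p) auto
  also have "\<dots> = ennreal (c powr q * (doob_const p * j))"
    using p j by (simp add: g_norm doob_const_def flip: ennreal_mult)
  also have "c powr q * (doob_const p * j) = 2 powr (q - p) * doob_const p * j powr (q / p)"
  proof -
    have e: "(1 - p / q) * q = q - p" "(1 / p - 1 / q) * q = q / p - 1" using q p
        by (auto simp: field_simps)
    have "c powr q = 2 powr ((1 - p / q) * q) * j powr ((1 / p - 1 / q) * q)"
      using j unfolding c_def by (subst powr_mult) (simp_all only: powr_powr powr_ge_zero)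
    moreover have "j powr (q / p - 1) * j = j powr (q / p)"
      using j powr_add[of j "q / p - 1" 1] by simp
    ultimately show ?thesis unfolding e by (metis mult.assoc mult.left_commute)
  qed
  finally show ?thesis .
qed

text \<open>
  Chosen so that \<open>k mu\<close> is \<open>N powr (1 / \<theta>) dx\<close>: a mean of \<open>k\<close> for \<open>mu\<close> is an integral with respect
  to the original measure.
\<close>

definition "k x = epowr (N x) (1 / \<theta>) * ennreal (1 / u x)"

lemma k_meas [measurable]: "k \<in> borel_measurable M"
  unfolding k_def[abs_def] by measurable

lemma k_u: "ennreal (u x) * k x = epowr (N x) (1 / \<theta>)"
proof -
  have "ennreal (u x) * ennreal (1 / u x) = 1"
    using us_pos(1)[of x] by (simp flip: ennreal_mult)
  moreover have "ennreal (u x) * k x = epowr (N x) (1 / \<theta>) * (ennreal (u x) * ennreal (1 / u x))"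
    unfolding k_def by (simp only: ac_simps)
  ultimately show ?thesis by simp
qed

text \<open>
  This is where the weight constant enters. On \<open>Q\<close> the function \<open>N\<close> is at least
  \<open>b powr (- \<gamma>) * i\<close>, so the mean of \<open>k\<close> for \<open>mu\<close> is at least \<open>m / a\<close> times its power \<open>1 / \<theta>\<close>, with
  \<open>a = mu Q\<close>, \<open>b = ms Q\<close>, \<open>m = |Q|\<close>. It remains to see that
  \<open>a powr \<theta> * b powr \<gamma> \<le> K powr \<theta> * m powr (\<theta> + \<gamma>)\<close>, which is the power \<open>\<theta>\<close> of the \<open>A\<^bsub>p,q\<^esub>\<close>
  condition because \<open>\<theta> * q / p' = \<gamma>\<close>.
\<close>

lemma fractional_mean_le:
  assumes Q: "Q \<in> D"
  shows "fractional_mean \<gamma> M h Q \<le> ennreal (K powr \<theta>) * epowr (mean mu k Q) \<theta>"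
proof -
  have [measurable]: "Q \<in> sets M" using Q D_sets by auto
  define m where "m = measure M Q"
  have m: "0 < m" "emeasure M Q = ennreal m" using D_pos[OF Q] D_fin[OF Q] by (auto simp: m_def)
  obtain a b where ab: "0 < a" "0 < b" "emeasure mu Q = ennreal a" "emeasure ms Q = ennreal b"
    and cond: "a * b powr (q / p') \<le> K * m powr (1 + q / p')"
    using weight_masses[OF Q(1)] unfolding m_def by metis
  obtain i where i: "(\<integral>\<^sup>+x\<in>Q. h x \<partial>M) = ennreal i" "0 \<le> i"
    using holder[OF Q(1) ab(2,4)] by (cases "\<integral>\<^sup>+x\<in>Q. h x \<partial>M") (auto simp: top_unique)
  have "ennreal (m * (b powr (- \<gamma>) * i) powr (1 / \<theta>))
      = ennreal ((b powr (- \<gamma>) * i) powr (1 / \<theta>)) * emeasure M Q"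
    using m by (simp add: ennreal_mult mult.commute)
  also have "\<dots> = (\<integral>\<^sup>+x\<in>Q. ennreal ((b powr (- \<gamma>) * i) powr (1 / \<theta>)) \<partial>M)"
    by (simp add: nn_integral_cmult_indicator)
  also have "\<dots> \<le> (\<integral>\<^sup>+x\<in>Q. k x \<partial>mu)"
    unfolding mu_def
  proof (subst nn_integral_density)
    show "(\<integral>\<^sup>+x\<in>Q. ennreal ((b powr (- \<gamma>) * i) powr (1 / \<theta>)) \<partial>M)
        \<le> (\<integral>\<^sup>+x. ennreal (u x) * (k x * indicator Q x) \<partial>M)"
    proof (rule nn_integral_mono)
      fix x
      have "ennreal ((b powr (- \<gamma>) * i) powr (1 / \<theta>)) \<le> epowr (N x) (1 / \<theta>)" if "x \<in> Q"
      proof -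
        have "ennreal (b powr (- \<gamma>) * i) \<le> N x"
          using family_maximal_upper[OF Q that, of "\<lambda>Q. ennreal (measure ms Q powr (- \<gamma>))
              * (\<integral>\<^sup>+x\<in>Q. h x \<partial>M)"] i ab
          by (simp add: N_def measure_def ennreal_mult)
        then show ?thesis using exps epowr_mono[of "1 / \<theta>" "ennreal (b powr (- \<gamma>) * i)" "N x"] i
            by (simp add: epowr_ennreal)
      qed
      then show "ennreal ((b powr (- \<gamma>) * i) powr (1 / \<theta>)) * indicator Q x
          \<le> ennreal (u x) * (k x * indicator Q x)"
        by (auto simp: indicator_def k_u)
    qed
  qed auto
  finally have "ennreal (m * (b powr (- \<gamma>) * i) powr (1 / \<theta>) / a) \<le> mean mu k Q"
    unfolding mean_def ab(3) using ab m
        by (subst divide_ennreal[symmetric]) (auto intro!: divide_right_mono_ennreal)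
  then have *: "ennreal (K powr \<theta>) * epowr (ennreal (m * (b powr (- \<gamma>) * i) powr (1 / \<theta>) / a)) \<theta>
      \<le> ennreal (K powr \<theta>) * epowr (mean mu k Q) \<theta>"
    using exps by (intro mult_left_mono epowr_mono) auto
  have "m powr (- \<gamma>) * i \<le> K powr \<theta> * (m * (b powr (- \<gamma>) * i) powr (1 / \<theta>) / a) powr \<theta>"
  proof -
    have "(a * b powr (q / p')) powr \<theta> \<le> (K * m powr (1 + q / p')) powr \<theta>"
      using cond ab exps by (intro powr_mono2) auto
    also have "(a * b powr (q / p')) powr \<theta> = a powr \<theta> * b powr \<gamma>"
      using ab exps(5) by (simp add: powr_mult powr_powr mult.commute)
    also have "(K * m powr (1 + q / p')) powr \<theta> = K powr \<theta> * m powr \<theta> * m powr \<gamma>"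
    proof -
      have e: "(1 + q / p') * \<theta> = \<theta> + \<gamma>" using exps(5) by (simp add: algebra_simps)
      have "(m powr (1 + q / p')) powr \<theta> = m powr ((1 + q / p') * \<theta>)" by (rule powr_powr)
      also have "\<dots> = m powr \<theta> * m powr \<gamma>" unfolding e by (rule powr_add)
      finally have "(m powr (1 + q / p')) powr \<theta> = m powr \<theta> * m powr \<gamma>" .
      then show ?thesis using K m by (simp add: powr_mult)
    qed
    finally have le: "a powr \<theta> * b powr \<gamma> \<le> K powr \<theta> * m powr \<theta> * m powr \<gamma>" .
    have "m powr (- \<gamma>) \<le> K powr \<theta> * m powr \<theta> / a powr \<theta> * b powr (- \<gamma>)"
      using le ab m by (simp add: powr_minus field_simps)
    then have "m powr (- \<gamma>) * i \<le> (K powr \<theta> * m powr \<theta> / a powr \<theta> * b powr (- \<gamma>)) * i"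
      using i by (intro mult_right_mono) auto
    also have "\<dots> = K powr \<theta> * (m * (b powr (- \<gamma>) * i) powr (1 / \<theta>) / a) powr \<theta>"
      using ab m i exps by (simp add: powr_mult powr_divide powr_powr)
    finally show ?thesis .
  qed
  then have "ennreal (m powr (- \<gamma>) * i)
      \<le> ennreal (K powr \<theta>) * epowr (ennreal (m * (b powr (- \<gamma>) * i) powr (1 / \<theta>) / a)) \<theta>"
    using ab m i exps by (simp add: epowr_ennreal ennreal_leI flip: ennreal_mult)
  with * show ?thesis using i m by (simp add: fractional_mean_def m_def ennreal_mult)
qed

text \<open>
  The maximal theorem for \<open>mu\<close> with exponent \<open>\<theta> * q\<close> reduces the claim to the integral of
  \<open>k powr (\<theta> * q)\<close> for \<open>mu\<close>. As \<open>1 - \<theta> * q = - p' / q\<close> and \<open>u powr (- p' / q) = s\<close>, that integral is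
  the one of \<open>N powr q\<close> for \<open>ms\<close>, bounded by \<open>N_norm\<close>.
\<close>

lemma weighted_bound_aux:
  "(\<integral>\<^sup>+x. epowr (ennreal (v x) * family_maximal D (fractional_mean \<gamma> M h) x) q \<partial>M)
   \<le> ennreal (K powr (\<theta> * q) * doob_const (\<theta> * q))
       * ennreal (2 powr (q - p) * doob_const p * j powr (q / p))"
proof -
  have sets_mu: "D \<subseteq> sets mu" using D by (simp add: mu_def)
  have [measurable]: "k \<in> borel_measurable mu" by (simp add: mu_def)
  have [measurable]: "family_maximal D (mean mu k) \<in> borel_measurable M" using D by measurable
  then have [measurable]: "family_maximal D (mean mu k) \<in> borel_measurable mu" by (simp add: mu_def)
  have "(\<integral>\<^sup>+x. epowr (ennreal (v x) * family_maximal D (fractional_mean \<gamma> M h) x) q \<partial>M)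
    \<le> (\<integral>\<^sup>+x. ennreal (K powr (\<theta> * q))
        * (ennreal (u x) * epowr (family_maximal D (mean mu k) x) (\<theta> * q)) \<partial>M)"
  proof (rule nn_integral_mono)
    fix x
    have "family_maximal D (fractional_mean \<gamma> M h) x
      \<le> ennreal (K powr \<theta>) * epowr (family_maximal D (mean mu k) x) \<theta>"
    proof (rule family_maximal_least)
      fix Q assume Q: "Q \<in> D" "x \<in> Q"
      note fractional_mean_le[OF Q(1)]
      also have "ennreal (K powr \<theta>) * epowr (mean mu k Q) \<theta>
          \<le> ennreal (K powr \<theta>) * epowr (family_maximal D (mean mu k) x) \<theta>"
        using Q exps by (intro mult_left_mono epowr_mono family_maximal_upper) auto
      finally show "fractional_mean \<gamma> M h Q \<le> \<dots>" .
    qed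
    then have "epowr (ennreal (v x) * family_maximal D (fractional_mean \<gamma> M h) x) q
      \<le> epowr (ennreal (v x) * (ennreal (K powr \<theta>) * epowr (family_maximal D (mean mu k) x) \<theta>)) q"
      using q by (intro epowr_mono mult_left_mono) auto
    also have "\<dots> = ennreal (K powr (\<theta> * q))
        * (ennreal (u x) * epowr (family_maximal D (mean mu k) x) (\<theta> * q))"
      using q v_pos[of x] K exps
          by (simp add: epowr_mult epowr_epowr epowr_ennreal_pos u_def powr_powr) (simp only: ac_simps)
    finally show "epowr (ennreal (v x) * family_maximal D (fractional_mean \<gamma> M h) x) q \<le> \<dots>" .
  qed
  also have "\<dots> = ennreal (K powr (\<theta> * q))
      * (\<integral>\<^sup>+x. epowr (family_maximal D (mean mu k) x) (\<theta> * q) \<partial>mu)"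
    by (simp add: nn_integral_cmult nn_integral_mu)
  also have "\<dots> \<le> ennreal (K powr (\<theta> * q))
      * (ennreal (doob_const (\<theta> * q)) * (\<integral>\<^sup>+x. epowr (k x) (\<theta> * q) \<partial>mu))"
    by (intro mult_left_mono maximal_strong_type sigma_finite_weights D sets_mu D_fin_weights exps) auto
  also have "(\<integral>\<^sup>+x. epowr (k x) (\<theta> * q) \<partial>mu) = (\<integral>\<^sup>+x. epowr (N x) q \<partial>ms)"
    unfolding mu_def ms_def
  proof (subst (1 2) nn_integral_density)
    show "(\<integral>\<^sup>+x. ennreal (u x) * epowr (k x) (\<theta> * q) \<partial>M) = (\<integral>\<^sup>+x. ennreal (s x) * epowr (N x) q \<partial>M)"
    proof (rule nn_integral_cong)
      fix x
      have "u x * (1 / u x) powr (\<theta> * q) = s x"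
      proof -
        have "u x * (1 / u x) powr (\<theta> * q) = u x powr (1 - \<theta> * q)"
          using us_pos[of x] by (simp add: powr_divide powr_diff)
        also have "\<dots> = s x"
          using q v_pos[of x] by (simp add: exps(3) u_def s_def powr_powr)
        finally show ?thesis .
      qed
      then have "ennreal (u x) * epowr (ennreal (1 / u x)) (\<theta> * q) = ennreal (s x)"
        using us_pos[of x] by (simp add: epowr_ennreal_pos flip: ennreal_mult)
      moreover have "epowr (k x) (\<theta> * q) = epowr (N x) q * epowr (ennreal (1 / u x)) (\<theta> * q)"
      proof -
        have "1 / \<theta> * (\<theta> * q) = q" using exps(2) by simp
        then show ?thesis using exps(2,4) epowr_epowr[of "1 / \<theta>" "N x" "\<theta> * q"]
          by (simp only: k_def epowr_mult zero_less_divide_1_iff less_imp_le order.strict_trans[OF zero_less_one])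
      qed
      then have "ennreal (u x) * epowr (k x) (\<theta> * q)
          = epowr (N x) q * (ennreal (u x) * epowr (ennreal (1 / u x)) (\<theta> * q))"
        by (simp only: ac_simps)
      ultimately show "ennreal (u x) * epowr (k x) (\<theta> * q) = ennreal (s x) * epowr (N x) q"
        by (simp only: mult.commute)
    qed
  qed auto
  also have "ennreal (K powr (\<theta> * q)) * (ennreal (doob_const (\<theta> * q)) * (\<integral>\<^sup>+x. epowr (N x) q \<partial>ms))
    \<le> ennreal (K powr (\<theta> * q))
        * (ennreal (doob_const (\<theta> * q)) * ennreal (2 powr (q - p) * doob_const p * j powr (q / p)))"
    by (intro mult_left_mono N_norm) auto
  also have "\<dots> = ennreal (K powr (\<theta> * q) * doob_const (\<theta> * q))
      * ennreal (2 powr (q - p) * doob_const p * j powr (q / p))"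
    using doob_const_pos[OF exps(4)] by (subst ennreal_mult) (simp_all add: mult.assoc)
  finally show ?thesis .
qed

end

definition "weighted_const = doob_const (\<theta> * q) * (2 powr (q - p) * doob_const p)"

lemma weighted_bound:
  assumes [measurable]: "h \<in> borel_measurable M"
  shows "(\<integral>\<^sup>+x. epowr (ennreal (v x) *
        family_maximal D (fractional_mean \<gamma> M h) x) q \<partial>M)
   \<le> ennreal (weighted_const * K powr (\<theta> * q))
       * epowr (\<integral>\<^sup>+x. epowr (ennreal (v x) * h x) p \<partial>M) (q / p)"
proof (cases "\<integral>\<^sup>+x. epowr (ennreal (v x) * h x) p \<partial>M")
  case (real j)
  have qp: "0 < q / p" using p q by simp
  show ?thesis
  proof (cases "j = 0")
    case True
    with real have "(\<integral>\<^sup>+x. epowr (ennreal (v x) * h x) p \<partial>M) = 0" by simp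
    then have "AE x in M. epowr (ennreal (v x) * h x) p = 0"
      by (subst (asm) nn_integral_0_iff_AE) auto
    then have "AE x in M. h x = 0"
      by eventually_elim (use p v_pos in \<open>auto simp: epowr_eq_0_iff ennreal_eq_0_iff not_le[symmetric]\<close>)
    then have "(\<integral>\<^sup>+x\<in>Q. h x \<partial>M) = 0" for Q
      by (subst nn_integral_cong_AE[of _ "\<lambda>x. 0"]) (auto elim!: eventually_mono)
    moreover have "family_maximal D (\<lambda>Q. 0) x = 0" for x
      using family_maximal_least[of D x "\<lambda>Q. 0" 0] by simp
    ultimately show ?thesis using q by (simp add: epowr_zero fractional_mean_def[abs_def])
  next
    case False
    then have j: "0 < j" using real by simp
    have "ennreal (K powr (\<theta> * q) * doob_const (\<theta> * q))
        * ennreal (2 powr (q - p) * doob_const p * j powr (q / p))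
      = ennreal (weighted_const * K powr (\<theta> * q)) * ennreal (j powr (q / p))"
      using doob_const_pos[OF exps(4)] doob_const_pos[OF p]
      by (simp add: weighted_const_def mult_ac flip: ennreal_mult)
    then show ?thesis
      using weighted_bound_aux[OF assms j real(2)] j by (simp add: real(2) epowr_ennreal_pos)
  qed
next
  case top
  have "0 < q / p" "0 < weighted_const"
    using p q exps by (auto simp: weighted_const_def doob_const_pos)
  then show ?thesis
    using top K by (simp add: epowr_top[unfolded infinity_ennreal_def] ennreal_mult_top)
qed

end

section \<open>Dyadic grids and cubes\<close>

text \<open>
  The one-third trick. Multiplication by \<open>2\<close> exchanges the residues \<open>1 / 3\<close> and \<open>2 / 3\<close> modulo \<open>1\<close>, so
  with shifts alternating with the parity of the level the shifted end points of level \<open>k + 1\<close> are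
  again shifted end points of level \<open>k\<close>.
\<close>

definition grid_shift :: "int \<Rightarrow> real"
  where "grid_shift k = (if even k then 1 / 3 else 2 / 3)"

definition grid_point :: "bool \<Rightarrow> int \<Rightarrow> int \<Rightarrow> real"
  where "grid_point b k m = 2 powr k * (m + (if b then grid_shift k else 0))"

text \<open>
  The flag \<open>t i\<close> decides whether the \<open>i\<close>-th coordinate uses the shifted or the standard dyadic
  intervals. Cells are half-open, so that the cells of a fixed level are disjoint.
\<close>

definition grid_cell :: "('n \<Rightarrow> bool) \<Rightarrow> int \<Rightarrow> ('n \<Rightarrow> int) \<Rightarrow> (real ^ 'n) set"
  where "grid_cell t k m = {x. \<forall>i. grid_point (t i) k (m i)
      \<le> x $ i \<and> x $ i < grid_point (t i) k (m i + 1)}"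

definition grid :: "('n \<Rightarrow> bool) \<Rightarrow> (real ^ 'n) set set"
  where "grid t = {grid_cell t k m | k m. True}"

lemma grid_point_Suc: "grid_point b k (m + 1) = grid_point b k m + 2 powr k"
  by (simp add: grid_point_def algebra_simps)

lemma grid_point_less_iff: "grid_point b k m < grid_point b k n \<longleftrightarrow> m < n"
  by (simp add: grid_point_def)

lemma grid_point_le_iff: "grid_point b k m \<le> grid_point b k n \<longleftrightarrow> m \<le> n"
  by (simp add: grid_point_def)

lemma grid_point_refine: "\<exists>n. grid_point b (k + int j) m = grid_point b k n"
proof (induction j arbitrary: m)
  case (Suc j)
  have "\<exists>n. grid_point b (k + int j + 1) m = grid_point b (k + int j) n"
  proof (intro exI)
    let ?k = "k + int j"
    have "2 powr real_of_int (?k + 1) = 2 powr ?k * 2" by (simp add: powr_add)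
    then show "grid_point b (?k + 1) m = grid_point b ?k (2 * m + (if b \<and> even ?k then 1 else 0))"
      by (auto simp: grid_point_def grid_shift_def algebra_simps)
  qed
  then show ?case using Suc.IH by (metis add.assoc of_nat_Suc add.commute)
qed auto

lemma grid_interval_nested:
  assumes "k \<le> k'"
    and "grid_point b k m \<le> x" "x < grid_point b k (m + 1)"
    and "grid_point b k' n \<le> x" "x < grid_point b k' (n + 1)"
  shows "grid_point b k' n \<le> grid_point b k m" "grid_point b k (m + 1) \<le> grid_point b k' (n + 1)"
proof -
  obtain j where "k' = k + int j" using zle_iff_zadd[of k k'] assms(1) by auto
  then obtain a c where ac: "grid_point b k' n = grid_point b k a" "grid_point b k' (n + 1)
      = grid_point b k c"
    using grid_point_refine[of b k j] by metis
  have "grid_point b k a < grid_point b k (m + 1)" "grid_point b k m < grid_point b k c"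
    using assms ac by linarith+
  then show "grid_point b k' n \<le> grid_point b k m" "grid_point b k (m + 1)
      \<le> grid_point b k' (n + 1)"
    by (simp_all add: ac grid_point_less_iff grid_point_le_iff)
qed

lemma grid_cell_nested:
  assumes "k \<le> k'" "x \<in> grid_cell t k m" "x \<in> grid_cell t k' n"
  shows "grid_cell t k m \<subseteq> grid_cell t k' n"
proof
  fix y assume y: "y \<in> grid_cell t k m"
  show "y \<in> grid_cell t k' n"
    unfolding grid_cell_def
  proof (safe)
    fix i
    have "grid_point (t i) k (m i) \<le> x $ i" "x $ i < grid_point (t i) k (m i + 1)"
      "grid_point (t i) k' (n i) \<le> x $ i" "x $ i < grid_point (t i) k' (n i + 1)"
      "grid_point (t i) k (m i) \<le> y $ i" "y $ i < grid_point (t i) k (m i + 1)"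
      using assms(2,3) y by (auto simp: grid_cell_def)
    then show "grid_point (t i) k' (n i) \<le> y $ i" "y $ i < grid_point (t i) k' (n i + 1)"
      using grid_interval_nested[OF assms(1), of "t i" "m i" "x $ i" "n i"] by linarith+
  qed
qed

lemma laminar_grid: "laminar (grid t)"
proof -
  have "P \<subseteq> Q \<or> Q \<subseteq> P \<or> P \<inter> Q = {}" if "P \<in> grid t" "Q \<in> grid t" for P Q
  proof -
    from that obtain k m k' n where P: "P = grid_cell t k m" and Q: "Q = grid_cell t k' n"
      unfolding grid_def by blast
    show ?thesis
    proof (cases "k \<le> k'")
      case True
      then show ?thesis unfolding P Q using grid_cell_nested[of k k' _ t m n] by blast
    next
      case False
      then show ?thesis unfolding P Q using grid_cell_nested[of k' k _ t n m] by fastforce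
    qed
  qed
  then show ?thesis unfolding laminar_def by blast
qed

lemma countable_grid: "countable (grid (t :: 'n::finite \<Rightarrow> bool))"
proof -
  have "grid t = range (\<lambda>(k, m). grid_cell t k m)" by (auto simp: grid_def)
  then show ?thesis by simp
qed

lemma measure_cube:
  fixes a b :: "real ^ 'n"
  assumes "0 < l" "\<And>i. b $ i - a $ i = l"
  shows "emeasure lebesgue (cbox a b) = ennreal (l ^ CARD('n))" "emeasure lebesgue (box a b)
      = ennreal (l ^ CARD('n))"
    "measure lebesgue (cbox a b) = l ^ CARD('n)"
proof -
  have le: "a $ i \<le> b $ i" for i using assms(2)[of i] assms(1) by linarith
  then have ne: "cbox a b \<noteq> {}" using interval_ne_empty_cart(1)[of a b] by auto
  show m: "measure lebesgue (cbox a b) = l ^ CARD('n)"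
    using content_cbox_cart[OF ne] assms by simp
  have bas: "\<forall>i\<in>Basis. a \<bullet> i \<le> b \<bullet> i" using le by (auto simp: Basis_vec_def inner_axis)
  have "emeasure lebesgue (cbox a b) = ennreal (measure lebesgue (cbox a b))"
    by (rule emeasure_eq_ennreal_measure) (simp add: emeasure_lborel_cbox_eq)
  then show "emeasure lebesgue (cbox a b) = ennreal (l ^ CARD('n))" using m by simp
  moreover have "emeasure lebesgue (cbox a b) = emeasure lebesgue (box a b)"
    using emeasure_lborel_cbox_eq[of a b] emeasure_lborel_box_eq[of a b] by simp
  ultimately show "emeasure lebesgue (box a b) = ennreal (l ^ CARD('n))" by simp
qed

lemma cube_side:
  assumes "Q \<in> (cubes :: (real ^ 'n) set set)"
  obtains a b l where "Q = cbox a b" "0 < l" "\<And>i. b $ i - a $ i = l" "emeasure lebesgue Q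
      = ennreal (l ^ CARD('n))"
    "measure lebesgue Q = l ^ CARD('n)"
  using assms measure_cube unfolding cubes_def by blast

text \<open>
  A half-open cell lies between an open and a closed box with equal measures; the closed one is the
  cube to which the \<open>A\<^bsub>p,q\<^esub>\<close> condition is applied.
\<close>

lemma grid_cell_cube:
  fixes t :: "'n::finite \<Rightarrow> bool"
  obtains Q where "Q \<in> cubes" "grid_cell t k m \<subseteq> Q" "grid_cell t k m \<in> sets lebesgue"
    "measure lebesgue Q = (2 powr k) ^ CARD('n)" "measure lebesgue (grid_cell t k m)
        = (2 powr k) ^ CARD('n)"
    "measure lebesgue Q = measure lebesgue (grid_cell t k m)"
proof -
  define a b :: "real ^ 'n" where "a = (\<chi> i. grid_point (t i) k (m i))" and "b
      = (\<chi> i. grid_point (t i) k (m i + 1))"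
  have l: "b $ i - a $ i = 2 powr k" for i by (simp add: a_def b_def grid_point_Suc)
  note m = measure_cube[of "2 powr k" b a, OF _ l, simplified]
  have sub: "grid_cell t k m \<subseteq> cbox a b" "box a b \<subseteq> grid_cell t k m"
    by (auto simp: grid_cell_def mem_box_cart a_def b_def less_imp_le)
  have "grid_cell t k m = (\<Inter>i. {x. grid_point (t i) k (m i)
      \<le> x $ i} \<inter> {x. x $ i < grid_point (t i) k (m i + 1)})"
    by (auto simp: grid_cell_def)
  also have "\<dots> \<in> sets borel"
    by (intro sets.countable_INT'' sets.Int borel_closed borel_open closed_Collect_le open_Collect_less continuous_intros) auto
  finally have meas: "grid_cell t k m \<in> sets lebesgue" by auto
  have "emeasure lebesgue (grid_cell t k m) = ennreal ((2 powr k) ^ CARD('n))"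
    using emeasure_mono[OF sub(1), of lebesgue] emeasure_mono[OF sub(2), of lebesgue] meas m
        by (intro antisym) auto
  then have "measure lebesgue (grid_cell t k m) = (2 powr k) ^ CARD('n)" by (simp add: measure_def)
  moreover have "measure lebesgue (cbox a b) = (2 powr k) ^ CARD('n)"
    using l by (intro measure_cube) auto
  moreover have "cbox a b \<in> cubes" using l unfolding cubes_def
      by (intro CollectI exI[of _ a] exI[of _ b] conjI exI[of _ "2 powr k"]) auto
  ultimately show thesis using that meas sub(1) by metis
qed

lemma grid_cell_measure:
  fixes t :: "'n::finite \<Rightarrow> bool"
  shows "measure lebesgue (grid_cell t k m) = (2 powr k) ^ CARD('n)"
  using grid_cell_cube[of t k m] by metis

lemma dyadic_scale:
  assumes "0 < (l::real)" obtains k :: int where "3 * l < 2 powr k" "2 powr k \<le> 6 * l"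
proof -
  define k where "k = \<lfloor>log 2 (3 * l)\<rfloor> + 1"
  have "log 2 (3 * l) < k" "k \<le> log 2 (3 * l) + 1" unfolding k_def by linarith+
  then have "2 powr log 2 (3 * l) < 2 powr k" "2 powr k \<le> 2 powr (log 2 (3 * l) + 1)"
    by (simp_all)
  then show thesis using that assms by (simp add: powr_add)
qed

text \<open>
  A standard interval of length \<open>2 powr k\<close> fails to contain \<open>[a, a + l]\<close> only if an integer multiple
  of \<open>2 powr k\<close> lies in it. The shifted end points are at distance at least \<open>2 powr k / 3 > l\<close> from
  that multiple, so the shifted interval around it does contain \<open>[a, a + l]\<close>.
\<close>

lemma interval_in_grid:
  assumes "0 < l" "3 * l < 2 powr (k::int)"
  shows "\<exists>b m. grid_point b k m \<le> a \<and> a + l < grid_point b k (m + 1)"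
proof -
  define y where "y = a / 2 powr k"
  define e where "e = l / 2 powr k"
  define m where "m = \<lfloor>y\<rfloor>"
  have a: "a = 2 powr k * y" "a + l = 2 powr k * (y + e)"
    by (simp_all add: y_def e_def distrib_left)
  have e: "e < 1 / 3" using assms by (simp add: e_def field_simps)
  have m: "m \<le> y" "y < m + 1" by (simp_all add: m_def)
  have *: "grid_point b k n \<le> a \<and> a + l < grid_point b k (n + 1)"
    if "n + (if b then grid_shift k else 0) \<le> y" "y + e < n + 1 + (if b then grid_shift k else 0)"
        for b n
  proof -
    have "2 powr k * (n + (if b then grid_shift k else 0)) \<le> 2 powr k * y"
      "2 powr k * (y + e) < 2 powr k * (n + 1 + (if b then grid_shift k else 0))"
      using that by simp_all
    then show ?thesis by (simp only: grid_point_def a(2) flip: a(1))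
  qed
  show ?thesis
  proof (cases "y + e < m + 1")
    case True
    then show ?thesis using *[of m False] m by auto
  next
    case False
    then show ?thesis using *[of m True] m e
        by (intro exI[of _ True] exI[of _ m]) (auto simp: grid_shift_def)
  qed
qed

lemma cube_in_grid:
  assumes "Q \<in> (cubes :: (real ^ 'n) set set)"
  obtains t P where "P \<in> grid t" "Q \<subseteq> P" "measure lebesgue P \<le> 6 ^ CARD('n) * measure lebesgue Q"
proof -
  obtain a b l where Q: "Q = cbox a b" "0 < l" "\<And>i. b $ i - a $ i = l" "measure lebesgue Q
      = l ^ CARD('n)"
    using cube_side[OF assms] by metis
  obtain k :: int where k: "3 * l < 2 powr k" "2 powr k \<le> 6 * l" using dyadic_scale[OF Q(2)] .
  have "\<forall>i. \<exists>b m. grid_point b k m \<le> a $ i \<and> a $ i + l < grid_point b k (m + 1)"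
    using interval_in_grid[OF Q(2) k(1)] by blast
  then obtain t m where tm: "\<And>i. grid_point (t i) k (m i)
      \<le> a $ i" "\<And>i. a $ i + l < grid_point (t i) k (m i + 1)"
    by metis
  have "Q \<subseteq> grid_cell t k m"
  proof
    fix x assume x: "x \<in> Q"
    show "x \<in> grid_cell t k m" unfolding grid_cell_def
    proof safe
      fix i
      have "a $ i \<le> x $ i" "x $ i \<le> a $ i + l"
        using x Q(1) Q(3)[of i] spec[of "\<lambda>i. a $ i \<le> x $ i \<and> x $ i \<le> b $ i" i]
            by (auto simp: mem_box_cart)
      then show "grid_point (t i) k (m i) \<le> x $ i" "x $ i < grid_point (t i) k (m i + 1)"
        using tm[of i] by linarith+
    qed
  qed
  moreover have "measure lebesgue (grid_cell t k m) \<le> 6 ^ CARD('n) * measure lebesgue Q"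
    using k power_mono[of "2 powr k" "6 * l" "CARD('n)"]
        by (simp add: Q(4) power_mult_distrib grid_cell_measure)
  ultimately show thesis using that[of "grid_cell t k m" t] by (auto simp: grid_def)
qed

lemma frac_maximal_le_grids:
  fixes f :: "real ^ 'n \<Rightarrow> real"
  assumes \<gamma>: "\<gamma> = 1 - \<alpha> / CARD('n)" "0 < \<gamma>"
  shows "frac_maximal \<alpha> f x \<le> ennreal ((6 ^ CARD('n)) powr \<gamma>) * (SUP t. family_maximal (grid t)
     (fractional_mean \<gamma> lebesgue (\<lambda>y. ennreal \<bar>f y\<bar>)) x)"
  unfolding frac_maximal_def
proof (rule SUP_least, clarsimp)
  fix Q :: "(real ^ 'n) set" assume Q: "Q \<in> cubes" "x \<in> Q"
  obtain t P where P: "P \<in> grid t" "Q \<subseteq> P" "measure lebesgue P \<le> 6 ^ CARD('n) * measure lebesgue Q"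
    using cube_in_grid[OF Q(1)] .
  obtain l where l: "0 < l" "measure lebesgue Q = l ^ CARD('n)" using cube_side[OF Q(1)] by metis
  have mP: "0 < measure lebesgue P" using P(1) unfolding grid_def by (auto simp: grid_cell_measure)
  have "1 / measure lebesgue Q powr \<gamma> \<le> (6 ^ CARD('n)) powr \<gamma> * measure lebesgue P powr - \<gamma>"
  proof -
    have "measure lebesgue P powr \<gamma> \<le> (6 ^ CARD('n) * measure lebesgue Q) powr \<gamma>"
      using P(3) \<gamma> by (intro powr_mono2) auto
    also have "\<dots> = (6 ^ CARD('n)) powr \<gamma> * measure lebesgue Q powr \<gamma>" by (simp add: powr_mult)
    finally show ?thesis using mP l by (simp add: powr_minus field_simps)
  qed
  then have "ennreal (1 / measure lebesgue Q powr (1 - \<alpha> / CARD('n)))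
      * (\<integral>\<^sup>+y\<in>Q. ennreal \<bar>f y\<bar> \<partial>lebesgue)
    \<le> ennreal ((6 ^ CARD('n)) powr \<gamma> * measure lebesgue P powr - \<gamma>)
        * (\<integral>\<^sup>+y\<in>P. ennreal \<bar>f y\<bar> \<partial>lebesgue)"
    using P(2) unfolding \<gamma>(1)
        by (intro mult_mono ennreal_leI nn_integral_mono) (auto simp: indicator_def)
  also have "\<dots> = ennreal ((6 ^ CARD('n)) powr \<gamma>)
      * (fractional_mean \<gamma> lebesgue (\<lambda>y. ennreal \<bar>f y\<bar>) P)"
    by (simp add: fractional_mean_def ennreal_mult mult.assoc)
  also have "\<dots> \<le> ennreal ((6 ^ CARD('n)) powr \<gamma>) * (SUP t. family_maximal (grid t)
     (fractional_mean \<gamma> lebesgue (\<lambda>y. ennreal \<bar>f y\<bar>)) x)"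
    using P Q by (intro mult_left_mono SUP_upper2[of t] family_maximal_upper) auto
  finally show "ennreal (1 / measure lebesgue Q powr (1 - \<alpha> / CARD('n)))
      * (\<integral>\<^sup>+y\<in>Q. ennreal \<bar>f y\<bar> \<partial>lebesgue) \<le> \<dots>" .
qed

section \<open>The upper bound\<close>

lemma weight_measurable:
  fixes w :: "real ^ 'n \<Rightarrow> real"
  assumes "weight w" shows "w \<in> borel_measurable lebesgue"
proof -
  define K :: "nat \<Rightarrow> (real ^ 'n) set" where "K N = cbox (\<chi> i. - real N) (\<chi> i. real N)" for N
  have meas: "(\<lambda>x. indicator (K N) x *\<^sub>R w x) \<in> borel_measurable lebesgue" for N
  proof -
    have "w absolutely_integrable_on K N"
      using assms by (simp add: weight_def K_def)
    then show ?thesis unfolding set_integrable_def by (rule borel_measurable_integrable)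
  qed
  show ?thesis
  proof (rule borel_measurable_LIMSEQ_real[OF _ meas])
    fix x :: "real ^ 'n"
    have "eventually (\<lambda>N. x \<in> K N) sequentially"
    proof -
      obtain N where N: "norm x \<le> real N" using real_arch_simple by blast
      have "x \<in> K M" if "N \<le> M" for M
      proof -
        have "real N \<le> real M" using that by simp
        then have "- real M \<le> x $ i \<and> x $ i \<le> real M" for i
          using component_le_norm_cart[of x i] N by linarith
        then show ?thesis by (simp add: K_def mem_box_cart)
      qed
      then show ?thesis unfolding eventually_sequentially by blast
    qed
    then have "eventually (\<lambda>N. indicator (K N) x *\<^sub>R w x = w x) sequentially"
      by eventually_elim simp
    then show "(\<lambda>N. indicator (K N) x *\<^sub>R w x) \<longlonglongrightarrow> w x"
      by (rule tendsto_eventually)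
  qed
qed

lemma cube_sets: "Q \<in> cubes \<Longrightarrow> Q \<in> sets lebesgue"
  unfolding cubes_def by auto

lemma Apq_const_upper:
  "Q \<in> cubes \<Longrightarrow> average Q (\<lambda>x. epowr (ennreal (w x)) q) *
      epowr (average Q (\<lambda>x. epowr (ennreal (w x)) (- conj_exponent p))) (q / conj_exponent p)
          \<le> Apq_const p q w"
  unfolding Apq_const_def by (rule SUP_upper)

text \<open>
  If \<open>w\<close> does not vanish almost everywhere on a cube, the mean of \<open>w powr q\<close> there is not \<open>0\<close>, so the
  other factor must be finite, and \<open>w powr (- p')\<close> is finite almost everywhere on that cube. Every
  larger cube has the same property, and increasing cubes exhaust the space.
\<close>

lemma Apq_ae_positive:
  fixes w :: "real ^ 'n \<Rightarrow> real"
  assumes w: "w \<in> Apq p q" and p: "1 < p" and q: "0 < q"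
    and nz: "\<not> (AE x in lebesgue. w x = 0)"
  shows "AE x in lebesgue. w x \<noteq> 0"
proof -
  have [measurable]: "w \<in> borel_measurable lebesgue" using w
      by (auto simp: Apq_def weight_measurable)
  have w0: "0 \<le> w x" for x using w by (auto simp: Apq_def weight_def)
  have A: "Apq_const p q w < \<infinity>" using w by (simp add: Apq_def)
  have p': "0 < conj_exponent p" using p by (simp add: conj_exponent_def)
  define K :: "nat \<Rightarrow> (real ^ 'n) set" where "K N = cbox (\<chi> i. - real (Suc N)) (\<chi> i. real (Suc N))"
      for N
  have cube: "K N \<in> cubes" for N
    unfolding cubes_def K_def
    by (intro CollectI exI[of _ "\<chi> i. - real (Suc N)"] exI[of _ "\<chi> i. real (Suc N)"] conjI refl exI[of _ "2 * real (Suc N)"]) auto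
  have [measurable]: "K N \<in> sets lebesgue" for N by (rule cube_sets[OF cube])
  have cover: "\<exists>N\<ge>M. x \<in> K N" for x M
  proof -
    obtain N where N: "norm x \<le> real N" using real_arch_simple by blast
    have "x \<in> K (max N M)"
    proof -
      have "real N \<le> real (Suc (max N M))" by simp
      then have "- real (Suc (max N M)) \<le> x $ i \<and> x $ i \<le> real (Suc (max N M))" for i
        using component_le_norm_cart[of x i] N by linarith
      then show ?thesis unfolding K_def mem_box_cart by simp
    qed
    then show ?thesis by (intro exI[of _ "max N M"]) auto
  qed
  have mono: "K M \<subseteq> K N" if "M \<le> N" for M N
    using that by (auto simp: K_def mem_box_cart) (smt (verit) of_nat_le_iff)+
  obtain M where M: "\<not> (AE x in lebesgue. x \<in> K M \<longrightarrow> w x = 0)"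
  proof -
    have "\<not> (\<forall>M. AE x in lebesgue. x \<in> K M \<longrightarrow> w x = 0)"
      using nz cover[of 0] by (auto simp flip: AE_all_countable elim!: eventually_mono)
    then show thesis using that by blast
  qed
  have "AE x in lebesgue. x \<in> K N \<longrightarrow> w x \<noteq> 0" if "M \<le> N" for N
  proof -
    have m: "0 < 1 / measure lebesgue (K N)" using cube_side[OF cube[of N]]
        by (metis zero_less_divide_1_iff zero_less_power)
    have "average (K N) (\<lambda>x. epowr (ennreal (w x)) q) \<noteq> 0"
    proof
      assume "average (K N) (\<lambda>x. epowr (ennreal (w x)) q) = 0"
      then have "(\<integral>\<^sup>+x\<in>K N. epowr (ennreal (w x)) q \<partial>lebesgue) = 0"
        using m by (simp add: average_def)
      then have "AE x in lebesgue. epowr (ennreal (w x)) q * indicator (K N) x = 0"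
        by (subst (asm) nn_integral_0_iff_AE) auto
      then have "AE x in lebesgue. x \<in> K M \<longrightarrow> w x = 0"
        by eventually_elim (use mono[OF that] q w0 in \<open>auto simp: epowr_eq_0_iff ennreal_eq_0_iff indicator_def antisym split: if_splits\<close>)
      with M show False by simp
    qed
    then have "epowr (average (K N) (\<lambda>x. epowr (ennreal (w x)) (- conj_exponent p))) (q / conj_exponent p) \<noteq> \<infinity>"
      using order.strict_trans1[OF Apq_const_upper[OF cube] A, of N]
          by (auto simp: ennreal_mult_top)
    then have "average (K N) (\<lambda>x. epowr (ennreal (w x)) (- conj_exponent p)) \<noteq> \<infinity>"
      using q p' by (auto simp: epowr_top[unfolded infinity_ennreal_def])
    then have "(\<integral>\<^sup>+x\<in>K N. epowr (ennreal (w x)) (- conj_exponent p) \<partial>lebesgue) \<noteq> \<infinity>"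
      using m by (auto simp: average_def ennreal_mult_top)
    then have "AE x in lebesgue. epowr (ennreal (w x)) (- conj_exponent p) * indicator (K N) x \<noteq> \<infinity>"
      by (intro nn_integral_noteq_infinite) auto
    then show ?thesis
      by eventually_elim (use p' in \<open>auto simp: epowr_def\<close>)
  qed
  then have "AE x in lebesgue. \<forall>N. M \<le> N \<longrightarrow> x \<in> K N \<longrightarrow> w x \<noteq> 0"
    by (simp add: AE_all_countable)
  then show ?thesis by eventually_elim (use cover in blast)
qed

lemma average_product_le:
  assumes Q: "Q \<in> cubes" and K: "0 < K" and e: "0 < e"
    and le: "average Q F * epowr (average Q G) e \<le> ennreal K"
  shows "(\<integral>\<^sup>+x\<in>Q. F x \<partial>lebesgue) * epowr (\<integral>\<^sup>+x\<in>Q. G x \<partial>lebesgue) e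
      \<le> ennreal (K * measure lebesgue Q powr (1 + e))"
proof -
  define m where "m = measure lebesgue Q"
  have m: "0 < m" using cube_side[OF Q] unfolding m_def by (metis zero_less_power)
  define X where "X = (\<integral>\<^sup>+x\<in>Q. F x \<partial>lebesgue)"
  define Y where "Y = (\<integral>\<^sup>+x\<in>Q. G x \<partial>lebesgue)"
  have one: "ennreal (m powr (1 + e)) * (ennreal (1 / m) * ennreal ((1 / m) powr e)) = 1"
    using m by (simp add: powr_add powr_divide flip: ennreal_mult)
  have "X * epowr Y e = ennreal (m powr (1 + e)) * (ennreal (1 / m) * ennreal ((1 / m) powr e))
      * (X * epowr Y e)"
    by (simp only: one mult_1_left)
  also have "\<dots> = ennreal (m powr (1 + e)) * (average Q F * epowr (average Q G) e)"
    using m e by (simp add: average_def m_def[symmetric] X_def[symmetric] Y_def[symmetric] epowr_mult epowr_ennreal_pos) (simp only: mult_ac)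
  also have "\<dots> \<le> ennreal (m powr (1 + e)) * ennreal K"
    by (intro mult_left_mono le) auto
  also have "\<dots> = ennreal (K * m powr (1 + e))"
    using K by (simp add: mult.commute flip: ennreal_mult)
  finally show ?thesis by (simp add: X_def Y_def m_def)
qed

lemma Apq_weighted_laminar:
  fixes w v :: "real ^ 'n \<Rightarrow> real" and t :: "'n \<Rightarrow> bool"
  assumes v [measurable]: "v \<in> borel_measurable lebesgue" "\<And>x. 0 < v x"
      and ae: "AE x in lebesgue. w x = v x"
    and p: "1 < p" "p \<le> q" and K: "Apq_const p q w = ennreal K" "0 \<le> K"
  shows "weighted_laminar lebesgue (grid t) v p q K"
proof (rule weighted_laminar.intro)
  have p': "0 < conj_exponent p" using p by (simp add: conj_exponent_def)
  have avg: "average Q (\<lambda>x. epowr (ennreal (w x)) a) = average Q (\<lambda>x. ennreal (v x powr a))"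
      for Q and a
    unfolding average_def using ae v(2)
    by (intro arg_cong2[where f="(*)"] refl nn_integral_cong_AE) (auto simp: epowr_ennreal_pos elim!: eventually_mono)
  have le: "average Q (\<lambda>x. ennreal (v x powr q))
      * epowr (average Q (\<lambda>x. ennreal (v x powr (- conj_exponent p)))) (q / conj_exponent p)
      \<le> ennreal K"
    if "Q \<in> cubes" for Q
    using Apq_const_upper[OF that, of w q p] by (simp add: avg K)
  show K0: "0 < K"
  proof (rule ccontr)
    assume "\<not> 0 < K"
    then have "K = 0" using K by simp
    obtain Q :: "(real ^ 'n) set" where Q: "Q \<in> cubes" using grid_cell_cube by metis
    obtain l where l: "0 < l" "emeasure lebesgue Q = ennreal (l ^ CARD('n))" "measure lebesgue Q
        = l ^ CARD('n)"
      using cube_side[OF Q] by metis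
    have "0 < v x powr a" for x a using v(2)[of x] by simp
    then have "average Q (\<lambda>x. ennreal (v x powr a)) \<noteq> 0" for a
      using set_nn_integral_nonzero[of "\<lambda>x. v x powr a" lebesgue Q] v cube_sets[OF Q] l
          by (auto simp: average_def)
    then show False using le[OF Q] \<open>K = 0\<close> p p' by (auto simp: epowr_eq_0_iff)
  qed
  show "sigma_finite_measure lebesgue" by (rule sigma_finite_lebesgue)
  show "grid t \<subseteq> sets lebesgue" unfolding grid_def using grid_cell_cube by blast
  show "0 < measure lebesgue Q" if "Q \<in> grid t" for Q
    using that by (auto simp: grid_def grid_cell_measure)
  show "(\<integral>\<^sup>+x\<in>P. ennreal (v x powr q) \<partial>lebesgue) *
      epowr (\<integral>\<^sup>+x\<in>P. ennreal (v x powr (- conj_exponent p)) \<partial>lebesgue) (q / conj_exponent p)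
      \<le> ennreal (K * measure lebesgue P powr (1 + q / conj_exponent p))" if P: "P \<in> grid t" for P
  proof -
    obtain Q where Q: "Q \<in> cubes" "P \<subseteq> Q" "measure lebesgue Q = measure lebesgue P"
      using P unfolding grid_def by clarify (metis grid_cell_cube)
    have "(\<integral>\<^sup>+x\<in>P. ennreal (v x powr q) \<partial>lebesgue) *
      epowr (\<integral>\<^sup>+x\<in>P. ennreal (v x powr (- conj_exponent p)) \<partial>lebesgue) (q / conj_exponent p)
      \<le> (\<integral>\<^sup>+x\<in>Q. ennreal (v x powr q) \<partial>lebesgue) *
      epowr (\<integral>\<^sup>+x\<in>Q. ennreal (v x powr (- conj_exponent p)) \<partial>lebesgue) (q / conj_exponent p)"
      using Q(2) p p' by (intro mult_mono epowr_mono nn_integral_mono) (auto simp: indicator_def)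
    also have "\<dots> \<le> ennreal (K * measure lebesgue P powr (1 + q / conj_exponent p))"
      unfolding Q(3)[symmetric] using p p' by (intro average_product_le Q K0 le) auto
    finally show ?thesis .
  qed
qed (use p v countable_grid laminar_grid in auto)

lemma fractional_exponents:
  fixes \<alpha> n p q :: real
  assumes "0 \<le> \<alpha>" "\<alpha> < n" "1 < p" "\<alpha> = 0 \<or> p < n / \<alpha>" "1 / q = 1 / p - \<alpha> / n"
  shows "p \<le> q" "1 - \<alpha> / n = 1 / conj_exponent p + 1 / q" "0 < 1 - \<alpha> / n" "1 < q"
proof -
  have n: "0 < n" using assms by linarith
  have "\<alpha> / n < 1 / p"
  proof (cases "\<alpha> = 0")
    case False
    then show ?thesis using assms n
        by (simp add: pos_less_divide_eq pos_divide_less_eq mult.commute)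
  qed (use assms in simp)
  then have q: "0 < 1 / q" using assms by simp
  then have q0: "0 < q" by simp
  have "1 / q \<le> 1 / p" using assms n by simp
  then have "inverse q \<le> inverse p" by (simp only: inverse_eq_divide)
  then show pq: "p \<le> q" using q0 by (rule inverse_le_imp_le)
  show "1 < q" using pq assms(3) by linarith
  have "1 / conj_exponent p = 1 - 1 / p" using assms(3) by (simp add: conj_exponent_def field_simps)
  then show "1 - \<alpha> / n = 1 / conj_exponent p + 1 / q" using assms(5) by simp
  show "0 < 1 - \<alpha> / n" using assms(2) n by simp
qed

text \<open>
  Two weights that agree almost everywhere have the same means and norms, so \<open>w\<close> may be replaced by a
  positive \<open>v\<close> and \<open>|f|\<close> by the measurable \<open>h = |w f| / v\<close>. The
  maximum over the grids is estimated by the sum.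
\<close>

lemma fractional_maximal_bound:
  fixes w f :: "real ^ 'n \<Rightarrow> real" and \<alpha> p q :: real
  assumes \<alpha>: "0 \<le> \<alpha>" "\<alpha> < CARD('n)" and p: "1 < p" "\<alpha> = 0 \<or> p < CARD('n) / \<alpha>"
    and q: "1 / q = 1 / p - \<alpha> / CARD('n)"
    and w: "w \<in> Apq p q" and f: "in_Lp p (\<lambda>x. w x * f x)"
  defines "\<gamma> \<equiv> 1 - \<alpha> / CARD('n)"
  defines "c \<equiv> (6 ^ CARD('n)) powr \<gamma>
      * (real CARD('n \<Rightarrow> bool) * weighted_laminar.weighted_const p q) powr (1 / q)"
  shows "Lp_norm q (\<lambda>x. ennreal (w x) * frac_maximal \<alpha> f x)
    \<le> ennreal c * epowr (Apq_const p q w) (conj_exponent p / q * \<gamma>)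
        * Lp_norm p (\<lambda>x. ennreal \<bar>w x * f x\<bar>)"
proof (cases "AE x in lebesgue. w x = 0")
  case True
  note ex = fractional_exponents[OF \<alpha> p q]
  have "(\<integral>\<^sup>+x. epowr (ennreal (w x) * frac_maximal \<alpha> f x) q \<partial>lebesgue)
      = (\<integral>\<^sup>+x. 0 \<partial>(lebesgue :: (real ^ 'n) measure))"
    by (rule nn_integral_cong_AE) (use True ex in \<open>auto simp: epowr_zero elim!: eventually_mono\<close>)
  then show ?thesis using ex by (simp add: Lp_norm_def epowr_zero)
next
  case False
  note ex = fractional_exponents[OF \<alpha> p q, folded \<gamma>_def]
  have [measurable]: "w \<in> borel_measurable lebesgue" using w
      by (auto simp: Apq_def weight_measurable)
  have [measurable]: "(\<lambda>x. w x * f x) \<in> borel_measurable lebesgue" using f by (simp add: in_Lp_def)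
  have w0: "0 \<le> w x" for x using w by (auto simp: Apq_def weight_def)
  have pos: "AE x in lebesgue. w x \<noteq> 0"
    using Apq_ae_positive[OF w p(1) _ False] ex by simp
  define v where "v x = (if w x = 0 then 1 else w x)" for x
  have v [measurable]: "v \<in> borel_measurable lebesgue" unfolding v_def[abs_def] by measurable
  have v_pos: "0 < v x" for x using w0[of x] by (auto simp: v_def)
  have wv: "AE x in lebesgue. w x = v x" using pos by eventually_elim (simp add: v_def)
  define h where "h x = ennreal (\<bar>w x * f x\<bar> / v x)" for x
  have h [measurable]: "h \<in> borel_measurable lebesgue" unfolding h_def[abs_def] by measurable
  have fh: "AE x in lebesgue. ennreal \<bar>f x\<bar> = h x"
    using pos by eventually_elim (use w0 in \<open>auto simp: h_def v_def abs_mult\<close>)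
  obtain K where K: "Apq_const p q w = ennreal K" "0 \<le> K"
    using w by (cases "Apq_const p q w") (auto simp: Apq_def)
  define F where "F t = family_maximal (grid t) (fractional_mean \<gamma> lebesgue h)" for t :: "'n \<Rightarrow> bool"
  have wl: "weighted_laminar lebesgue (grid t) v p q K" for t :: "'n \<Rightarrow> bool"
    by (rule Apq_weighted_laminar[OF v v_pos wv p(1) ex(1) K])
  have K0: "0 < K" using weighted_laminar.K[OF wl[of "\<lambda>_. True"]] .
  define W where "W = weighted_laminar.weighted_const p q"
  define \<theta> where "\<theta> = conj_exponent p / q * \<gamma>"
  define J where "J = (\<integral>\<^sup>+x. epowr (ennreal \<bar>w x * f x\<bar>) p \<partial>lebesgue)"
  define b where "b = (6 ^ CARD('n)) powr \<gamma>"
  have b: "0 < b" by (simp add: b_def)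
  define N where "N = real CARD('n \<Rightarrow> bool)"
  have N: "0 < N" unfolding N_def by (simp add: card_gt_0_iff del: card_fun)
  have \<theta>: "weighted_laminar.\<gamma> p q = \<gamma>" "weighted_laminar.\<theta> p q = \<theta>"
    using weighted_laminar.\<gamma>_def[OF wl] weighted_laminar.\<theta>_def[OF wl] ex(2) by (simp_all add: \<theta>_def)
  have W: "0 < W"
    unfolding W_def weighted_laminar.weighted_const_def[OF wl]
    using doob_const_pos weighted_laminar.exps(4)[OF wl] p(1) by simp
  have J: "(\<integral>\<^sup>+x. epowr (ennreal (v x) * h x) p \<partial>lebesgue) = J"
  proof -
    have "v x \<noteq> 0" for x using v_pos[of x] by simp
    then show ?thesis
      unfolding J_def h_def using v_pos
      by (intro nn_integral_cong arg_cong2[where f=epowr] refl) (simp add: less_imp_le flip: ennreal_mult)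
  qed
  have F_bound: "(\<integral>\<^sup>+x. epowr (ennreal (v x) * F t x) q \<partial>lebesgue)
      \<le> ennreal (W * K powr (\<theta> * q)) * epowr J (q / p)" for t
    using weighted_laminar.weighted_bound[OF wl[of t] h] unfolding J \<theta> F_def W_def .
  have F_meas [measurable]: "F t \<in> borel_measurable lebesgue" for t
    unfolding F_def using weighted_laminar.D[OF wl[of t]] by (intro measurable_family_maximal)
  have M_le: "frac_maximal \<alpha> f x \<le> ennreal b * (SUP t. F t x)" for x
  proof -
    have "(\<integral>\<^sup>+y\<in>Q. ennreal \<bar>f y\<bar> \<partial>lebesgue) = (\<integral>\<^sup>+y\<in>Q. h y \<partial>lebesgue)" for Q
      by (rule nn_integral_cong_AE) (use fh in \<open>auto elim!: eventually_mono\<close>)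
    then show ?thesis
      using frac_maximal_le_grids[OF meta_eq_to_obj_eq[OF \<gamma>_def] ex(3), of f x]
      by (simp only: F_def b_def fractional_mean_def[abs_def])
  qed
  have "(\<integral>\<^sup>+x. epowr (ennreal (w x) * frac_maximal \<alpha> f x) q \<partial>lebesgue)
     \<le> (\<integral>\<^sup>+x. (\<Sum>t\<in>UNIV. ennreal (b powr q) * epowr (ennreal (v x) * F t x) q) \<partial>lebesgue)"
  proof (rule nn_integral_mono_AE)
    show "AE x in lebesgue. epowr (ennreal (w x) * frac_maximal \<alpha> f x) q
        \<le> (\<Sum>t\<in>UNIV. ennreal (b powr q) * epowr (ennreal (v x) * F t x) q)"
      using wv
    proof eventually_elim
      case (elim x)
      have "Max (range (\<lambda>t. F t x)) \<in> range (\<lambda>t. F t x)" by (intro Max_in) simp_all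
      moreover have "Max (range (\<lambda>t. F t x)) = (SUP t. F t x)" by (intro Max_Sup) simp_all
      ultimately have "(SUP t. F t x) \<in> range (\<lambda>t. F t x)" by simp
      then obtain t where t: "(SUP t. F t x) = F t x" by auto
      have "ennreal (v x) * frac_maximal \<alpha> f x \<le> ennreal (v x) * (ennreal b * F t x)"
        using M_le[of x] unfolding t by (rule mult_left_mono) simp
      then have "epowr (ennreal (w x) * frac_maximal \<alpha> f x) q
          \<le> epowr (ennreal b * (ennreal (v x) * F t x)) q"
        using ex(4) unfolding elim mult.left_commute[of "ennreal b"] by (intro epowr_mono) auto
      also have "\<dots> = ennreal (b powr q) * epowr (ennreal (v x) * F t x) q"
        using ex(4) b epowr_mult[of q "ennreal b" "ennreal (v x) * F t x"]
            by (simp add: epowr_ennreal_pos)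
      also have "\<dots> \<le> (\<Sum>t\<in>UNIV. ennreal (b powr q) * epowr (ennreal (v x) * F t x) q)"
        by (rule member_le_sum) auto
      finally show ?case .
    qed
  qed
  also have "\<dots> = (\<Sum>t\<in>UNIV. ennreal (b powr q) * (\<integral>\<^sup>+x. epowr (ennreal (v x) * F t x) q \<partial>lebesgue))"
    by (simp add: nn_integral_sum nn_integral_cmult)
  also have "\<dots> \<le> (\<Sum>t\<in>(UNIV :: ('n \<Rightarrow> bool) set). ennreal (b powr q)
      * (ennreal (W * K powr (\<theta> * q)) * epowr J (q / p)))"
    by (intro sum_mono mult_left_mono F_bound) auto
  also have "\<dots> = ennreal N * (ennreal (b powr q)
      * (ennreal (W * K powr (\<theta> * q)) * epowr J (q / p)))"
    by (simp only: sum_constant N_def ennreal_of_nat_eq_real_of_nat)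
  also have "\<dots> = ennreal (N * (b powr q * (W * K powr (\<theta> * q)))) * epowr J (q / p)"
    using W b N by (subst (1 2) ennreal_mult) (simp_all add: mult.assoc)
  finally have "Lp_norm q (\<lambda>x. ennreal (w x) * frac_maximal \<alpha> f x) \<le>
      epowr (ennreal (N * (b powr q * (W * K powr (\<theta> * q)))) * epowr J (q / p)) (1 / q)"
    unfolding Lp_norm_def using ex by (intro epowr_mono) auto
  also have "\<dots> = ennreal ((N * (b powr q * (W * K powr (\<theta> * q)))) powr (1 / q)) * epowr J (1 / p)"
    using ex p W b K0 N by (simp add: epowr_mult epowr_epowr epowr_ennreal_pos)
  also have "(N * (b powr q * (W * K powr (\<theta> * q)))) powr (1 / q) = c * K powr \<theta>"
  proof -
    have "c = b * (N * W) powr (1 / q)" by (simp only: c_def b_def N_def W_def)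
    then show ?thesis using ex(4) W b K0 N by (simp add: powr_mult powr_powr)
  qed
  also have "ennreal (c * K powr \<theta>) = ennreal c * epowr (Apq_const p q w) (conj_exponent p / q * \<gamma>)"
    using K0 W b by (subst ennreal_mult) (simp_all add: c_def K epowr_ennreal_pos \<theta>_def)
  finally show ?thesis by (simp add: Lp_norm_def J_def)
qed

section \<open>Integrals of powers of the maximum norm\<close>

lemma infnorm_le_iff_cart: "infnorm (x :: real ^ 'n) \<le> c \<longleftrightarrow> (\<forall>i. \<bar>x $ i\<bar> \<le> c)"
proof
  assume "infnorm x \<le> c"
  then show "\<forall>i. \<bar>x $ i\<bar> \<le> c" using component_le_infnorm_cart[of x] order_trans by blast
next
  assume "\<forall>i. \<bar>x $ i\<bar> \<le> c"
  then show "infnorm x \<le> c" unfolding infnorm_cart by (intro cSup_least) auto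
qed

text \<open>
  Balls of the maximum norm are cubes centred at the origin, which makes their measures explicit.
\<close>

definition sup_ball :: "real \<Rightarrow> (real ^ 'n) set"
  where "sup_ball r = {x. infnorm x \<le> r}"

lemma sup_ball_cbox: "sup_ball r = cbox (\<chi> i. - r) (\<chi> i. r)"
  unfolding sup_ball_def infnorm_le_iff_cart by (auto simp: mem_box_cart abs_le_iff minus_le_iff)

lemma sup_ball_cube: "0 < r \<Longrightarrow> sup_ball r \<in> cubes"
  unfolding cubes_def sup_ball_cbox
  by (intro CollectI exI[of _ "\<chi> i. - r"] exI[of _ "\<chi> i. r"] conjI refl exI[of _ "2 * r"]) auto

lemma sup_ball_measure:
  assumes "0 < r"
  shows "emeasure lebesgue (sup_ball r :: (real ^ 'n) set) = ennreal ((2 * r) ^ CARD('n))"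
    "measure lebesgue (sup_ball r :: (real ^ 'n) set) = (2 * r) ^ CARD('n)"
  unfolding sup_ball_cbox using assms by (intro measure_cube; simp)+

lemma measurable_infnorm [measurable]: "(infnorm :: real ^ 'n \<Rightarrow> real) \<in> borel_measurable borel"
  by (intro borel_measurable_continuous_onI continuous_intros)

lemma measurable_infnorm_lebesgue [measurable]: "(infnorm :: real ^ 'n \<Rightarrow> real) \<in> borel_measurable lebesgue"
  using measurable_infnorm by (auto intro: measurable_completion)

lemma sup_ball_sets [measurable]: "sup_ball r \<in> sets lebesgue"
  by (simp add: sup_ball_cbox)

lemma one_minus_half_power:
  assumes "0 < d" "d \<le> (1::real)"
  shows "1 - 2 powr - d \<le> d" "d / 4 \<le> 1 - 2 powr - d"
proof -
  have l: "1 / 2 \<le> ln (2::real)" "ln (2::real) \<le> 1" using ln2_ge_two_thirds ln_2_less_1 by auto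
  have "1 + (- d * ln 2) \<le> exp (- d * ln 2)" by (rule exp_ge_add_one_self)
  moreover have "d * ln 2 \<le> d * 1" using l assms by (intro mult_left_mono) auto
  ultimately show "1 - 2 powr - d \<le> d" by (simp add: powr_def)
  have "1 + d / 2 \<le> 1 + d * ln 2" using l assms mult_left_mono[of "1/2" "ln 2" d] by simp
  also have "\<dots> \<le> 2 powr d" using exp_ge_add_one_self[of "d * ln 2"] by (simp add: powr_def)
  finally have "2 powr - d \<le> 1 / (1 + d / 2)"
    using assms by (simp add: powr_minus inverse_eq_divide frac_le)
  also have "\<dots> \<le> 1 - d / 4" using assms by (simp add: field_simps)
  finally show "d / 4 \<le> 1 - 2 powr - d" by simp
qed

lemma sup_ball_annuli:
  assumes r: "0 < r"
  shows "disjoint_family (\<lambda>k. sup_ball (r / 2 ^ k) - sup_ball (r / 2 ^ Suc k) :: (real ^ 'n) set)"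
    "(\<Union>k. sup_ball (r / 2 ^ k) - sup_ball (r / 2 ^ Suc k) :: (real ^ 'n) set) = sup_ball r - {0}"
proof -
  have mono: "r / 2 ^ j \<le> r / 2 ^ i" if "i \<le> j" for i j :: nat
    using that r by (intro divide_left_mono power_increasing) auto
  have aux: "(sup_ball (r / 2 ^ i) - sup_ball (r / 2 ^ Suc i)) \<inter> (sup_ball (r / 2 ^ j) - sup_ball (r / 2 ^ Suc j)) = {}"
    if "i < j" for i j
    using mono[of "Suc i" j] that by (auto simp: sup_ball_def)
  show "disjoint_family (\<lambda>k. sup_ball (r / 2 ^ k) - sup_ball (r / 2 ^ Suc k) :: (real ^ 'n) set)"
    unfolding disjoint_family_on_def using aux by (metis Int_commute linorder_neqE_nat)
  show "(\<Union>k. sup_ball (r / 2 ^ k) - sup_ball (r / 2 ^ Suc k) :: (real ^ 'n) set) = sup_ball r - {0}"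
  proof (intro equalityI subsetI)
    fix x :: "real ^ 'n" assume "x \<in> (\<Union>k. sup_ball (r / 2 ^ k) - sup_ball (r / 2 ^ Suc k))"
    then obtain k where k: "infnorm x \<le> r / 2 ^ k" "r / 2 ^ Suc k < infnorm x"
        by (auto simp: sup_ball_def)
    have "0 < r / 2 ^ Suc k" using r by simp
    then show "x \<in> sup_ball r - {0}" using k mono[of 0 k] infnorm_pos_lt[of x]
        by (auto simp: sup_ball_def)
  next
    fix x :: "real ^ 'n" assume x: "x \<in> sup_ball r - {0}"
    then have pos: "0 < infnorm x" by (simp add: infnorm_pos_lt)
    have "\<exists>k. r / 2 ^ Suc k < infnorm x"
    proof -
      obtain k where "(1 / 2) ^ k < infnorm x / r"
        using real_arch_pow_inv[of "infnorm x / r" "1 / 2"] pos r by auto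
      then have "r / 2 ^ k < infnorm x" using r by (simp add: field_simps power_one_over)
      then show ?thesis using mono[of k "Suc k"] by (intro exI[of _ k]) simp
    qed
    then obtain k where k: "r / 2 ^ Suc k < infnorm x" and least: "\<And>j. j < k
        \<Longrightarrow> \<not> r / 2 ^ Suc j < infnorm x"
      using exists_least_iff[of "\<lambda>k. r / 2 ^ Suc k < infnorm x"] by auto
    have "infnorm x \<le> r / 2 ^ k"
    proof (cases k)
      case 0
      then show ?thesis using x by (simp add: sup_ball_def)
    next
      case (Suc j)
      then show ?thesis using least[of j] by simp
    qed
    then show "x \<in> (\<Union>k. sup_ball (r / 2 ^ k) - sup_ball (r / 2 ^ Suc k))" using k
        by (auto simp: sup_ball_def)
  qed
qed

text \<open>
  On the annulus between radii \<open>r / 2 ^ (k + 1)\<close> and \<open>r / 2 ^ k\<close> the integrand is comparable to its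
  value on the outer sphere, and its integral to \<open>(r / 2 ^ k) powr d\<close>. The geometric series of ratio
  \<open>2 powr (- d)\<close> has sum \<open>1 / (1 - 2 powr (- d))\<close>, which is comparable to \<open>1 / d\<close>. The exact order in
  \<open>d\<close> is the source of the sharp exponent.
\<close>

lemma integral_infnorm_powr:
  fixes r d :: real
  assumes r: "0 < r" and d: "0 < d" "d \<le> 1"
  defines "I \<equiv> (\<integral>\<^sup>+x\<in>sup_ball r. ennreal (infnorm x powr (d - CARD('n))) \<partial>(lebesgue :: (real ^ 'n) measure))"
  shows "ennreal (r powr d / d) \<le> I" "I \<le> ennreal (4 ^ (CARD('n) + 1) * r powr d / d)"
proof -
  let ?n = "CARD('n)"
  have n: "1 \<le> real ?n" by (simp add: Suc_le_eq)
  have dn: "d - ?n \<le> 0" using n d by linarith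
  define A :: "nat \<Rightarrow> (real ^ 'n) set" where "A k
      = sup_ball (r / 2 ^ k) - sup_ball (r / 2 ^ Suc k)" for k
  define F where "F x = ennreal (infnorm x powr (d - ?n))" for x :: "real ^ 'n"
  have [measurable]: "F \<in> borel_measurable lebesgue" unfolding F_def[abs_def] by measurable
  have [measurable]: "A k \<in> sets lebesgue" for k unfolding A_def by measurable
  have I: "I = (\<Sum>k. \<integral>\<^sup>+x\<in>A k. F x \<partial>lebesgue)"
  proof -
    have "F x * indicator (sup_ball r) x = (\<Sum>k. F x * indicator (A k) x)" for x
    proof -
      have "(\<Sum>k. F x * indicator (A k) x) = F x * indicator (\<Union>k. A k) x"
        using suminf_indicator[OF sup_ball_annuli(1)[OF r], of x] by (simp add: A_def)
      also have "\<dots> = F x * indicator (sup_ball r) x"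
        unfolding A_def sup_ball_annuli(2)[OF r] by (auto simp: F_def indicator_def infnorm_0)
      finally show ?thesis by simp
    qed
    then have "I = (\<integral>\<^sup>+x. (\<Sum>k. F x * indicator (A k) x) \<partial>lebesgue)"
      unfolding I_def F_def[symmetric] by (simp only:)
    also have "\<dots> = (\<Sum>k. \<integral>\<^sup>+x\<in>A k. F x \<partial>lebesgue)"
      by (rule nn_integral_suminf) measurable
    finally show ?thesis .
  qed
  have mA: "emeasure lebesgue (A k) = ennreal ((2 ^ ?n - 1) * (r / 2 ^ k) ^ ?n)" for k
  proof -
    have "emeasure lebesgue (A k)
        = ennreal ((2 * (r / 2 ^ k)) ^ ?n) - ennreal ((2 * (r / 2 ^ Suc k)) ^ ?n)"
    proof -
      have p: "0 < r / 2 ^ k" "0 < r / 2 ^ Suc k" using r by simp_all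
      have sub: "(sup_ball (r / 2 ^ Suc k) :: (real ^ 'n) set) \<subseteq> sup_ball (r / 2 ^ k)"
        using p by (auto simp: sup_ball_def)
      have "emeasure lebesgue (sup_ball (r / 2 ^ Suc k) :: (real ^ 'n) set) \<noteq> \<infinity>"
        unfolding sup_ball_measure(1)[OF p(2)] by simp
      from emeasure_Diff[OF this sup_ball_sets sup_ball_sets sub]
      show ?thesis unfolding A_def sup_ball_measure(1)[OF p(1)] sup_ball_measure(1)[OF p(2)] .
    qed
    also have "\<dots> = ennreal ((2 * (r / 2 ^ k)) ^ ?n - (r / 2 ^ k) ^ ?n)"
      using r by (subst ennreal_minus) auto
    also have "(2 * (r / 2 ^ k)) ^ ?n - (r / 2 ^ k) ^ ?n = (2 ^ ?n - 1) * (r / 2 ^ k) ^ ?n"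
      by (simp only: power_mult_distrib left_diff_distrib mult_1_left)
    finally show ?thesis .
  qed
  define S where "S = (2 ^ ?n - 1) * r powr d / (1 - 2 powr - d)"
  have q: "0 < 2 powr - d" "2 powr - d < 1" using d by (auto intro: powr_less_one)
  have pow: "(r / 2 ^ k) powr (d - ?n) * (r / 2 ^ k) ^ ?n = r powr d * (2 powr - d) ^ k" for k
  proof -
    have p: "0 < r / 2 ^ k" using r by simp
    have "(r / 2 ^ k) powr (d - ?n) * (r / 2 ^ k) ^ ?n = (r / 2 ^ k) powr d"
      using p by (simp add: powr_diff powr_realpow del: divide_pos_pos)
    also have "\<dots> = r powr d * (2 powr - d) ^ k"
      using r by (simp add: powr_divide powr_power powr_minus field_simps flip: powr_realpow) (simp add: powr_powr mult.commute flip: powr_add)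
    finally show ?thesis .
  qed
  have S: "(\<Sum>k. ennreal ((2 ^ ?n - 1) * (r powr d * (2 powr - d) ^ k))) = ennreal S"
  proof (rule suminf_ennreal_eq)
    have "(\<lambda>k. (2 ^ ?n - 1) * (r powr d * (2 powr - d) ^ k)) sums ((2 ^ ?n - 1)
        * (r powr d * (1 / (1 - 2 powr - d))))"
      using q by (intro sums_mult geometric_sums) auto
    then show "(\<lambda>k. (2 ^ ?n - 1) * (r powr d * (2 powr - d) ^ k)) sums S" by (simp add: S_def)
  qed auto
  have bounds: "(r / 2 ^ k) powr (d - ?n) \<le> infnorm x powr (d - ?n)"
    "infnorm x powr (d - ?n) \<le> 2 ^ ?n * (r / 2 ^ k) powr (d - ?n)" if "x \<in> A k" for x k
  proof -
    have x: "infnorm x \<le> r / 2 ^ k" "r / 2 ^ Suc k < infnorm x" using that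
        by (auto simp: A_def sup_ball_def)
    have p: "0 < r / 2 ^ Suc k" using r by simp
    show "(r / 2 ^ k) powr (d - ?n) \<le> infnorm x powr (d - ?n)"
      using x p dn by (intro powr_mono2') linarith+
    have "infnorm x powr (d - ?n) \<le> (r / 2 ^ Suc k) powr (d - ?n)"
      using x p dn by (intro powr_mono2') linarith+
    also have "\<dots> = 2 powr (?n - d) * (r / 2 ^ k) powr (d - ?n)"
    proof -
      have "r / 2 ^ Suc k = (1 / 2) * (r / 2 ^ k)" by simp
      moreover have "(1 / 2) powr (d - ?n) = 2 powr (?n - d)" by (simp add: powr_divide powr_diff)
      ultimately show ?thesis using r by (simp only: powr_mult)
    qed
    also have "\<dots> \<le> 2 ^ ?n * (r / 2 ^ k) powr (d - ?n)"
      using d by (intro mult_right_mono) (auto simp flip: powr_realpow)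
    finally show "infnorm x powr (d - ?n) \<le> 2 ^ ?n * (r / 2 ^ k) powr (d - ?n)" .
  qed
  have two: "(1::real) \<le> 2 ^ ?n - 1" using n power_increasing[of 1 ?n "2::real"]
      by (simp add: Suc_le_eq)
  have "ennreal S \<le> I"
    unfolding I S[symmetric]
  proof (intro suminf_le summableI)
    fix k
    have "ennreal ((2 ^ ?n - 1) * (r powr d * (2 powr - d) ^ k))
        = ennreal ((r / 2 ^ k) powr (d - ?n)) * emeasure lebesgue (A k)"
      using two r unfolding mA pow[symmetric] by (simp add: mult_ac flip: ennreal_mult)
    also have "\<dots> = (\<integral>\<^sup>+x\<in>A k. ennreal ((r / 2 ^ k) powr (d - ?n)) \<partial>lebesgue)"
      by (rule nn_integral_cmult_indicator[symmetric]) measurable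
    also have "\<dots> \<le> (\<integral>\<^sup>+x\<in>A k. F x \<partial>lebesgue)"
      using bounds(1) by (intro nn_integral_mono) (auto simp: F_def indicator_def ennreal_leI)
    finally show "ennreal ((2 ^ ?n - 1) * (r powr d * (2 powr - d) ^ k))
        \<le> (\<integral>\<^sup>+x\<in>A k. F x \<partial>lebesgue)" .
  qed
  moreover have "r powr d / d \<le> S"
  proof -
    have "r powr d / d \<le> r powr d / (1 - 2 powr - d)"
      using one_minus_half_power[OF d] q by (intro divide_left_mono) (auto simp: d)
    also have "\<dots> \<le> S" unfolding S_def using two q
        by (intro divide_right_mono) (auto simp: mult_le_cancel_right1)
    finally show ?thesis .
  qed
  ultimately show "ennreal (r powr d / d) \<le> I" by (meson ennreal_leI order_trans)
  have "I \<le> (\<Sum>k. ennreal (2 ^ ?n) * ennreal ((2 ^ ?n - 1) * (r powr d * (2 powr - d) ^ k)))"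
    unfolding I
  proof (intro suminf_le summableI)
    fix k
    have "(\<integral>\<^sup>+x\<in>A k. F x \<partial>lebesgue)
        \<le> (\<integral>\<^sup>+x\<in>A k. ennreal (2 ^ ?n * (r / 2 ^ k) powr (d - ?n)) \<partial>lebesgue)"
      using bounds(2) by (intro nn_integral_mono) (auto simp: F_def indicator_def ennreal_leI)
    also have "\<dots> = ennreal (2 ^ ?n * (r / 2 ^ k) powr (d - ?n)) * emeasure lebesgue (A k)"
      by (rule nn_integral_cmult_indicator) measurable
    also have "\<dots> = ennreal (2 ^ ?n) * ennreal ((2 ^ ?n - 1) * (r powr d * (2 powr - d) ^ k))"
      using two r unfolding mA pow[symmetric] by (simp add: mult_ac flip: ennreal_mult)
    finally show "(\<integral>\<^sup>+x\<in>A k. F x \<partial>lebesgue) \<le> \<dots>" .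
  qed
  also have "\<dots> = ennreal (2 ^ ?n) * ennreal S" by (simp add: S)
  also have "\<dots> = ennreal (2 ^ ?n * S)" by (subst ennreal_mult') auto
  also have "\<dots> \<le> ennreal (4 ^ (?n + 1) * r powr d / d)"
  proof (rule ennreal_leI)
    have "S \<le> (2 ^ ?n - 1) * r powr d / (d / 4)"
      unfolding S_def using one_minus_half_power[OF d] q two d by (intro divide_left_mono) auto
    also have "\<dots> \<le> 2 ^ ?n * r powr d / (d / 4)"
      using d by (intro divide_right_mono mult_right_mono) auto
    finally have "2 ^ ?n * S \<le> 2 ^ ?n * (2 ^ ?n * r powr d / (d / 4))"
        by (intro mult_left_mono) auto
    also have "\<dots> = 4 ^ (?n + 1) * r powr d / d"
    proof -
      have "(4::real) ^ ?n = 2 ^ ?n * 2 ^ ?n" by (simp flip: power_mult_distrib)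
      then show ?thesis by simp
    qed
    finally show "2 ^ ?n * S \<le> 4 ^ (?n + 1) * r powr d / d" .
  qed
  finally show "I \<le> ennreal (4 ^ (?n + 1) * r powr d / d)" .
qed

section \<open>Power weights\<close>

lemma average_le:
  assumes Q: "Q \<in> cubes" and le: "AE x in lebesgue. x \<in> Q \<longrightarrow> F x \<le> ennreal c" and c: "0 \<le> c"
  shows "average Q F \<le> ennreal c"
proof -
  obtain l where l: "0 < l" "emeasure lebesgue Q = ennreal (l ^ CARD('a))" "measure lebesgue Q
      = l ^ CARD('a)"
    using cube_side[OF Q] by metis
  have "(\<integral>\<^sup>+x\<in>Q. F x \<partial>lebesgue) \<le> (\<integral>\<^sup>+x\<in>Q. ennreal c \<partial>lebesgue)"
    by (rule nn_integral_mono_AE) (use le in \<open>auto simp: indicator_def elim!: eventually_mono\<close>)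
  also have "\<dots> = ennreal c * ennreal (l ^ CARD('a))"
    by (simp only: l(2)[symmetric] nn_integral_cmult_indicator[OF cube_sets[OF Q]])
  finally have "average Q F \<le> ennreal (1 / l ^ CARD('a)) * (ennreal c * ennreal (l ^ CARD('a)))"
    unfolding average_def l(3) by (rule mult_left_mono) simp
  also have "\<dots> = ennreal c" using l(1) c by (simp flip: ennreal_mult)
  finally show ?thesis .
qed

lemma average_ge:
  assumes Q: "Q \<in> cubes" and le: "AE x in lebesgue. x \<in> Q \<longrightarrow> ennreal c \<le> F x" and c: "0 \<le> c"
  shows "ennreal c \<le> average Q F"
proof -
  obtain l where l: "0 < l" "emeasure lebesgue Q = ennreal (l ^ CARD('a))" "measure lebesgue Q
      = l ^ CARD('a)"
    using cube_side[OF Q] by metis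
  have "ennreal c * ennreal (l ^ CARD('a)) = (\<integral>\<^sup>+x\<in>Q. ennreal c \<partial>lebesgue)"
    by (simp only: l(2)[symmetric] nn_integral_cmult_indicator[OF cube_sets[OF Q]])
  also have "\<dots> \<le> (\<integral>\<^sup>+x\<in>Q. F x \<partial>lebesgue)"
    by (rule nn_integral_mono_AE) (use le in \<open>auto simp: indicator_def elim!: eventually_mono\<close>)
  finally have "ennreal (1 / l ^ CARD('a)) * (ennreal c * ennreal (l ^ CARD('a))) \<le> average Q F"
    unfolding average_def l(3) by (rule mult_left_mono) simp
  moreover have "ennreal (1 / l ^ CARD('a)) * (ennreal c * ennreal (l ^ CARD('a))) = ennreal c"
    using l(1) c by (simp flip: ennreal_mult)
  ultimately show ?thesis by simp
qed

text \<open>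
  Here \<open>m\<close> is the largest maximum norm on the cube. If the side \<open>l\<close> is small compared with \<open>m\<close>, the
  norm is nearly constant on the cube; otherwise the cube is comparable to the ball of radius \<open>m\<close>.
\<close>

lemma cube_infnorm_max:
  assumes Q: "Q \<in> (cubes :: (real ^ 'n) set set)"
  obtains l m where "0 < l" "l \<le> 2 * m" "measure lebesgue Q = l ^ CARD('n)"
    "\<And>x. x \<in> Q \<Longrightarrow> infnorm x \<le> m" "\<And>x. x \<in> Q \<Longrightarrow> m - l \<le> infnorm x"
proof -
  obtain a b l where Q': "Q = cbox a b" "0 < l" "\<And>i. b $ i - a $ i = l" "measure lebesgue Q
      = l ^ CARD('n)"
    using cube_side[OF Q] by metis
  have comp: "a $ i \<le> x $ i" "x $ i \<le> a $ i + l" if "x \<in> Q" for x i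
    using that Q'(1) Q'(3)[of i] spec[of "\<lambda>i. a $ i \<le> x $ i \<and> x $ i \<le> b $ i" i]
        by (auto simp: mem_box_cart)
  have ab: "a \<in> Q" "b \<in> Q"
  proof -
    have "a $ i \<le> b $ i" for i using Q'(2) Q'(3)[of i] by linarith
    then show "a \<in> Q" "b \<in> Q" by (auto simp: Q'(1) mem_box_cart)
  qed
  have "compact Q" by (simp add: Q'(1))
  then have "\<exists>x\<in>Q. \<forall>y\<in>Q. infnorm y \<le> infnorm x"
    using ab(1) by (intro continuous_attains_sup continuous_intros) auto
  then obtain x0 where x0: "x0 \<in> Q" "\<And>x. x \<in> Q \<Longrightarrow> infnorm x \<le> infnorm x0" by blast
  show thesis
  proof (rule that[OF Q'(2) _ Q'(4) x0(2)])
    obtain i :: 'n where True by simp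
    show "l \<le> 2 * infnorm x0"
      using component_le_infnorm_cart[of a i] component_le_infnorm_cart[of b i] x0(2)[OF ab(1)] x0(2)[OF ab(2)] Q'(3)[of i] by linarith
    fix x assume x: "x \<in> Q"
    have "infnorm (x0 - x) \<le> l"
      unfolding infnorm_le_iff_cart
    proof
      fix i show "\<bar>(x0 - x) $ i\<bar> \<le> l"
        using comp[OF x, of i] comp[OF x0(1), of i] by (simp add: abs_le_iff)
    qed
    then show "infnorm x0 - l \<le> infnorm x" using infnorm_triangle[of "x0 - x" x] by simp
  qed
qed

definition power_weight_const :: "nat \<Rightarrow> real"
  where "power_weight_const N = 2 ^ N * 4 ^ (N + 1)"

text \<open>
  The dimension is a number \<open>N\<close> here, so that the exponents are functions of numbers alone; it is the
  dimension of the space in the lemmas about integrals.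
\<close>

context
  fixes \<alpha> p q d :: real and N :: nat
  assumes \<alpha>: "0 \<le> \<alpha>" "\<alpha> < real N" and p: "1 < p" "\<alpha> = 0 \<or> p < real N / \<alpha>"
    and q: "1 / q = 1 / p - \<alpha> / N" and d: "0 < d" "d < 1"
begin

definition "power_weight_exponent = (real N - d) / conj_exponent p"

lemma power_weight_exponents:
  shows "1 < conj_exponent p" "0 < power_weight_exponent" "power_weight_exponent
      * (- conj_exponent p) = d - N"
    "power_weight_exponent * p + (d - N) * p = d - N"
    "q * (power_weight_exponent - N * (1 - \<alpha> / N) + d) = q * d / p - N"
    "power_weight_exponent * q + (d - N) * (q / conj_exponent p) = 0"
proof -
  have n: "1 \<le> real N" using \<alpha> by (cases N) auto
  show p': "1 < conj_exponent p" using p by (simp add: conj_exponent_def field_simps)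
  show "0 < power_weight_exponent" using p' n d by (simp add: power_weight_exponent_def)
  show "power_weight_exponent * (- conj_exponent p) = d - N" using p'
      by (simp add: power_weight_exponent_def)
  have e: "power_weight_exponent = (real N - d) * (1 - 1 / p)" using p
      by (simp add: power_weight_exponent_def conj_exponent_def field_simps)
  show "power_weight_exponent * p + (d - N) * p = d - N" unfolding e using p
      by (simp add: field_simps)
  have q0: "q \<noteq> 0" using fractional_exponents(4)[OF \<alpha> p q] by simp
  have "N * (1 - \<alpha> / N) = N * (1 - 1 / p + 1 / q)" using q by simp
  then have "power_weight_exponent - N * (1 - \<alpha> / N) + d = d / p - N / q"
    unfolding e by (simp add: algebra_simps)
  then show "q * (power_weight_exponent - N * (1 - \<alpha> / N) + d) = q * d / p - N" using q0
      by (simp add: right_diff_distrib)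
  show "power_weight_exponent * q + (d - N) * (q / conj_exponent p) = 0" using p'
      by (simp add: power_weight_exponent_def field_simps)
qed

definition power_weight :: "real ^ 'n \<Rightarrow> real"
  where "power_weight x = infnorm x powr power_weight_exponent"

definition power_function :: "real ^ 'n \<Rightarrow> real"
  where "power_function x = indicator (sup_ball 1) x * infnorm x powr (d - N)"

lemma weight_power_weight: "weight (power_weight :: real ^ 'n \<Rightarrow> real)"
  unfolding weight_def
proof (intro conjI allI impI)
  fix K :: "(real ^ 'n) set" assume K: "compact K"
  then obtain a where a: "K \<subseteq> cbox (- a) a"
      using bounded_subset_cbox_symmetric compact_imp_bounded by metis
  have "continuous_on (cbox (- a) a) (power_weight :: real ^ 'n \<Rightarrow> real)"
    unfolding power_weight_def using power_weight_exponents(2) infnorm_pos_le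
        by (intro continuous_on_powr' continuous_intros) auto
  then have "(power_weight :: real ^ 'n \<Rightarrow> real) absolutely_integrable_on cbox (- a) a"
    by (rule absolutely_integrable_continuous)
  then show "(power_weight :: real ^ 'n \<Rightarrow> real) absolutely_integrable_on K"
    by (rule set_integrable_subset) (use a K in \<open>auto simp: compact_imp_closed\<close>)
qed (simp add: power_weight_def)

lemma ae_nonzero: "AE x in lebesgue. (x :: real ^ 'n) \<noteq> 0"
  using AE_lborel_singleton[of 0] by (rule AE_completion)

lemma epowr_power_weight:
  assumes "x \<noteq> 0"
  shows "epowr (ennreal (power_weight x)) a = ennreal (infnorm x powr (power_weight_exponent * a))"
proof -
  have "0 < infnorm x powr power_weight_exponent" using infnorm_pos_lt[of x] assms by simp
  then show ?thesis by (simp add: power_weight_def epowr_ennreal_pos powr_powr)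
qed

lemma average_power_weight: "average Q (\<lambda>x. epowr (ennreal (power_weight x)) a)
    = average Q (\<lambda>x. ennreal (infnorm x powr (power_weight_exponent * a)))"
  for Q :: "(real ^ 'n) set"
  unfolding average_def
  by (intro arg_cong2[where f="(*)"] refl nn_integral_cong_AE) (use ae_nonzero in \<open>auto simp: epowr_power_weight elim!: eventually_mono\<close>)

text \<open>
  The mean of \<open>w powr q\<close> is at most its largest value, attained where the norm is \<open>m\<close>. The mean of
  \<open>w powr (- p')\<close> is at most of order \<open>m powr (d - N) / d\<close>: for a cube small compared with \<open>m\<close> since
  the norm is at least \<open>m / 2\<close> there, and otherwise by comparison with the ball of radius \<open>m\<close>. The
  powers of \<open>m\<close> cancel.
\<close>

lemma power_weight_Apq_upper:
  assumes N: "N = CARD('n)"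
  shows "Apq_const p q (power_weight :: real ^ 'n \<Rightarrow> real)
      \<le> ennreal ((power_weight_const N / d) powr (q / conj_exponent p))"
  unfolding Apq_const_def
proof (rule SUP_least)
  fix Q :: "(real ^ 'n) set" assume Q: "Q \<in> cubes"
  obtain l m where l: "0 < l" "l \<le> 2 * m" "measure lebesgue Q = l ^ N"
    and m: "\<And>x. x \<in> Q \<Longrightarrow> infnorm x \<le> m" "\<And>x. x \<in> Q \<Longrightarrow> m - l \<le> infnorm x"
    using cube_infnorm_max[OF Q] unfolding N by metis
  have m0: "0 < m" using l by linarith
  have n: "1 \<le> real N" using \<alpha> by (cases N) auto
  have dn: "d - N \<le> 0" using d n by linarith
  have q0: "0 < q" using fractional_exponents(4)[OF \<alpha> p q] by simp
  note p' = power_weight_exponents(1)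
  have 1: "average Q (\<lambda>x. epowr (ennreal (power_weight x)) q)
      \<le> ennreal (m powr (power_weight_exponent * q))"
    unfolding average_power_weight
  proof (rule average_le[OF Q])
    show "AE x in lebesgue. x \<in> Q \<longrightarrow> ennreal (infnorm x powr (power_weight_exponent * q))
        \<le> ennreal (m powr (power_weight_exponent * q))"
      using m(1) q0 power_weight_exponents(2) infnorm_pos_le
          by (intro AE_I2 impI ennreal_leI powr_mono2) auto
  qed auto
  have "(1::real) \<le> 4 ^ (N + 1)" by (rule one_le_power) simp
  then have "d \<le> 4 ^ (N + 1)" using d by linarith
  then have C: "1 \<le> 4 ^ (N + 1) / d" "0 < power_weight_const N" using d
      by (simp_all only: le_divide_eq power_weight_const_def) auto
  have 2: "average Q (\<lambda>x. epowr (ennreal (power_weight x)) (- conj_exponent p))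
      \<le> ennreal (power_weight_const N / d * m powr (d - N))"
    unfolding average_power_weight power_weight_exponents(3)
  proof (cases "l \<le> m / 2")
    case True
    have "average Q (\<lambda>x. ennreal (infnorm x powr (d - N))) \<le> ennreal ((m / 2) powr (d - N))"
    proof (rule average_le[OF Q])
      show "AE x in lebesgue. x \<in> Q \<longrightarrow> ennreal (infnorm x powr (d - N))
          \<le> ennreal ((m / 2) powr (d - N))"
      proof (intro AE_I2 impI ennreal_leI powr_mono2' dn)
        fix x assume "x \<in> Q"
        show "m / 2 \<le> infnorm x" using m(2)[OF \<open>x \<in> Q\<close>] True by linarith
      qed (use m0 in auto)
    qed auto
    also have "(m / 2) powr (d - N) = 2 powr (N - d) * m powr (d - N)"
      using m0 by (simp add: powr_divide powr_diff)
    also have "\<dots> \<le> power_weight_const N / d * m powr (d - N)"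
    proof (rule mult_right_mono)
      have "2 powr (N - d) \<le> 2 ^ N * 1" using d by (simp flip: powr_realpow)
      also have "\<dots> \<le> 2 ^ N * (4 ^ (N + 1) / d)" using C(1) by (intro mult_left_mono) auto
      finally show "2 powr (N - d) \<le> power_weight_const N / d" by (simp add: power_weight_const_def)
    qed auto
    finally show "average Q (\<lambda>x. ennreal (infnorm x powr (d - N)))
        \<le> ennreal (power_weight_const N / d * m powr (d - N))"
      by (meson ennreal_leI order_trans)
  next
    case False
    have "(\<integral>\<^sup>+x\<in>Q. ennreal (infnorm x powr (d - N)) \<partial>lebesgue)
        \<le> (\<integral>\<^sup>+x\<in>sup_ball m. ennreal (infnorm x powr (d - N)) \<partial>(lebesgue :: (real ^ 'n) measure))"
      using m(1) by (intro nn_integral_mono) (auto simp: indicator_def sup_ball_def)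
    also have "\<dots> \<le> ennreal (4 ^ (N + 1) * m powr d / d)"
      using integral_infnorm_powr(2)[OF m0 d(1), where 'n = 'n] d unfolding N by simp
    finally have "average Q (\<lambda>x. ennreal (infnorm x powr (d - N)))
        \<le> ennreal (1 / l ^ N) * ennreal (4 ^ (N + 1) * m powr d / d)"
      unfolding average_def l(3) by (rule mult_left_mono) simp
    also have "\<dots> = ennreal (1 / l ^ N * (4 ^ (N + 1) * m powr d / d))"
      using l d by (subst ennreal_mult) auto
    also have "\<dots> \<le> ennreal (power_weight_const N / d * m powr (d - N))"
    proof (rule ennreal_leI)
      have "(m / 2) ^ N \<le> l ^ N" using False m0 by (intro power_mono) auto
      then have "1 / l ^ N \<le> 1 / (m / 2) ^ N" using m0 by (intro divide_left_mono) (auto simp: l)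
      then have "1 / l ^ N * (4 ^ (N + 1) * m powr d / d)
          \<le> 1 / (m / 2) ^ N * (4 ^ (N + 1) * m powr d / d)"
        using d by (intro mult_right_mono) auto
      also have "\<dots> = power_weight_const N / d * m powr (d - N)"
        using m0 by (simp add: power_weight_const_def powr_diff powr_realpow power_divide ac_simps)
      finally show "1 / l ^ N * (4 ^ (N + 1) * m powr d / d)
          \<le> power_weight_const N / d * m powr (d - N)" .
    qed
    finally show "average Q (\<lambda>x. ennreal (infnorm x powr (d - N)))
        \<le> ennreal (power_weight_const N / d * m powr (d - N))" .
  qed
  have "average Q (\<lambda>x. epowr (ennreal (power_weight x)) q) *
      epowr (average Q (\<lambda>x. epowr (ennreal (power_weight x)) (- conj_exponent p))) (q / conj_exponent p)
      \<le> ennreal (m powr (power_weight_exponent * q))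
          * epowr (ennreal (power_weight_const N / d * m powr (d - N))) (q / conj_exponent p)"
    using 1 2 q0 p' by (intro mult_mono epowr_mono) auto
  also have "\<dots> = ennreal (m powr (power_weight_exponent * q)
      * (power_weight_const N / d * m powr (d - N)) powr (q / conj_exponent p))"
    using d C(2) m0 by (simp add: epowr_ennreal_pos ennreal_mult)
  also have "m powr (power_weight_exponent * q)
      * (power_weight_const N / d * m powr (d - N)) powr (q / conj_exponent p)
      = (power_weight_const N / d) powr (q / conj_exponent p)"
  proof -
    have "(power_weight_const N / d * m powr (d - N)) powr (q / conj_exponent p)
        = (power_weight_const N / d) powr (q / conj_exponent p)
        * m powr ((d - N) * (q / conj_exponent p))"
      using d C(2) m0 by (subst powr_mult) (simp_all only: powr_powr)
    moreover have "m powr (power_weight_exponent * q) * m powr ((d - N) * (q / conj_exponent p))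
        = 1"
      using m0 power_weight_exponents(6) by (simp flip: powr_add)
    ultimately show ?thesis by simp
  qed
  finally show "average Q (\<lambda>x. epowr (ennreal (power_weight x)) q) *
      epowr (average Q (\<lambda>x. epowr (ennreal (power_weight x)) (- conj_exponent p))) (q / conj_exponent p)
      \<le> ennreal ((power_weight_const N / d) powr (q / conj_exponent p))" .
qed

text \<open>
  A single cube away from the origin and inside the unit ball suffices. This bound, uniform in \<open>d\<close>, is
  what excludes negative exponents.
\<close>

lemma power_weight_Apq_lower:
  assumes N: "N = CARD('n)"
  shows "ennreal ((1 / 2) powr (N * q)) \<le> Apq_const p q (power_weight :: real ^ 'n \<Rightarrow> real)"
proof -
  define Q :: "(real ^ 'n) set" where "Q = cbox (\<chi> i. 1 / 2) (\<chi> i. 1)"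
  have Q: "Q \<in> cubes"
    unfolding cubes_def Q_def
    by (intro CollectI exI[of _ "\<chi> i. 1 / 2"] exI[of _ "\<chi> i. 1"] conjI refl exI[of _ "1 / 2"]) auto
  have R: "1 / 2 \<le> infnorm x" "infnorm x \<le> 1" if "x \<in> Q" for x
  proof -
    have x: "1 / 2 \<le> x $ i" "x $ i \<le> 1" for i
      using that spec[of "\<lambda>i. 1 / 2 \<le> x $ i \<and> x $ i \<le> 1" i] by (auto simp: Q_def mem_box_cart)
    show "1 / 2 \<le> infnorm x" using x(1) component_le_infnorm_cart[of x]
        by (meson abs_ge_self order_trans)
    show "infnorm x \<le> 1" unfolding infnorm_le_iff_cart
    proof
      fix i show "\<bar>x $ i\<bar> \<le> 1" using x[of i] by linarith
    qed
  qed
  have n: "1 \<le> real N" using \<alpha> by (cases N) auto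
  have dn: "d - N \<le> 0" using d n by linarith
  have q0: "0 < q" using fractional_exponents(4)[OF \<alpha> p q] by simp
  note p' = power_weight_exponents(1)
  have en: "power_weight_exponent \<le> N"
  proof -
    have "power_weight_exponent \<le> (N - d) / 1" unfolding power_weight_exponent_def using p' dn
        by (intro divide_left_mono) auto
    then show ?thesis using d by simp
  qed
  have "ennreal ((1 / 2) powr (N * q)) \<le> average Q (\<lambda>x. epowr (ennreal (power_weight x)) q)"
    unfolding average_power_weight
  proof (rule average_ge[OF Q])
    have "(1 / 2) powr (N * q) \<le> infnorm x powr (power_weight_exponent * q)" if "x \<in> Q" for x
    proof -
      have "(1 / 2::real) powr (N * q) \<le> (1 / 2) powr (power_weight_exponent * q)"
        using en q0 by (intro powr_mono') auto
      also have "\<dots> \<le> infnorm x powr (power_weight_exponent * q)"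
        using R[OF that] q0 power_weight_exponents(2) by (intro powr_mono2) auto
      finally show ?thesis .
    qed
    then show "AE x in lebesgue. x \<in> Q \<longrightarrow> ennreal ((1 / 2) powr (N * q))
        \<le> ennreal (infnorm x powr (power_weight_exponent * q))"
      by (intro AE_I2 impI ennreal_leI)
  qed simp
  moreover have "ennreal 1 \<le> average Q (\<lambda>x. epowr (ennreal (power_weight x)) (- conj_exponent p))"
    unfolding average_power_weight power_weight_exponents(3)
  proof (rule average_ge[OF Q])
    have "1 \<le> infnorm x powr (d - N)" if "x \<in> Q" for x
      using R[OF that] dn powr_mono2'[of "d - N" "infnorm x" 1] by simp
    then show "AE x in lebesgue. x \<in> Q \<longrightarrow> ennreal 1 \<le> ennreal (infnorm x powr (d - N))"
      by (intro AE_I2 impI ennreal_leI)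
  qed simp
  then have "epowr (ennreal 1) (q / conj_exponent p)
      \<le> epowr (average Q (\<lambda>x. epowr (ennreal (power_weight x)) (- conj_exponent p))) (q / conj_exponent p)"
    using q0 p' by (intro epowr_mono) auto
  ultimately have "ennreal ((1 / 2) powr (N * q)) * epowr (ennreal 1) (q / conj_exponent p) \<le>
     average Q (\<lambda>x. epowr (ennreal (power_weight x)) q)
         * epowr (average Q (\<lambda>x. epowr (ennreal (power_weight x)) (- conj_exponent p))) (q / conj_exponent p)"
    by (intro mult_mono) auto
  also have "\<dots> \<le> Apq_const p q (power_weight :: real ^ 'n \<Rightarrow> real)" by (rule Apq_const_upper[OF Q])
  finally show ?thesis using epowr_ennreal_pos[of 1] by simp
qed

lemma power_weight_norm:
  assumes N: "N = CARD('n)"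
  shows "in_Lp p (\<lambda>x :: real ^ 'n. power_weight x * power_function x)"
    "Lp_norm p (\<lambda>x :: real ^ 'n. ennreal \<bar>power_weight x * power_function x\<bar>)
        \<le> ennreal ((4 ^ (N + 1) / d) powr (1 / p))"
proof -
  have "(\<integral>\<^sup>+x. epowr (ennreal \<bar>power_weight x
      * power_function x\<bar>) p \<partial>(lebesgue :: (real ^ 'n) measure)) =
     (\<integral>\<^sup>+x\<in>sup_ball 1. ennreal (infnorm x powr (d - N)) \<partial>(lebesgue :: (real ^ 'n) measure))"
  proof (rule nn_integral_cong)
    fix x :: "real ^ 'n"
    show "epowr (ennreal \<bar>power_weight x * power_function x\<bar>) p
        = ennreal (infnorm x powr (d - N)) * indicator (sup_ball 1) x"
    proof (cases "x \<in> sup_ball 1 \<and> x \<noteq> 0")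
      case True
      then have pos: "0 < infnorm x" by (simp add: infnorm_pos_lt)
      have "(infnorm x powr power_weight_exponent * infnorm x powr (d - N)) powr p
          = infnorm x powr (d - N)"
        using power_weight_exponents(4)
            by (simp only: powr_powr left_diff_distrib distrib_right flip: powr_add)
      then show ?thesis using True pos
          by (simp add: power_weight_def power_function_def epowr_ennreal_pos)
    qed (use p in \<open>auto simp: power_weight_def power_function_def epowr_zero infnorm_0\<close>)
  qed
  also have "\<dots> \<le> ennreal (4 ^ (N + 1) / d)"
    using integral_infnorm_powr(2)[of 1 d, where 'n = 'n] d unfolding N by simp
  finally have "Lp_norm p (\<lambda>x :: real ^ 'n. ennreal \<bar>power_weight x * power_function x\<bar>)
      \<le> epowr (ennreal (4 ^ (N + 1) / d)) (1 / p)"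
    unfolding Lp_norm_def using p by (intro epowr_mono) auto
  also have "\<dots> = ennreal ((4 ^ (N + 1) / d) powr (1 / p))" using d by (simp add: epowr_ennreal_pos)
  finally show le: "Lp_norm p (\<lambda>x :: real ^ 'n. ennreal \<bar>power_weight x * power_function x\<bar>) \<le> \<dots>" .
  have "(\<lambda>x :: real ^ 'n. power_weight x * power_function x) \<in> borel_measurable lebesgue"
    unfolding power_weight_def power_function_def by measurable
  then show "in_Lp p (\<lambda>x :: real ^ 'n. power_weight x * power_function x)"
    unfolding in_Lp_def using le by (auto intro: order.strict_trans1)
qed

text \<open>
  Test the supremum with the centred cube whose boundary contains \<open>x\<close>.
\<close>

lemma power_function_frac_maximal:
  assumes N: "N = CARD('n)" and x: "(x :: real ^ 'n) \<noteq> 0" "infnorm x \<le> 1"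
  shows "ennreal ((1 / 2) powr N / d * infnorm x powr (d - N * (1 - \<alpha> / N)))
      \<le> frac_maximal \<alpha> power_function x"
proof -
  define r where "r = infnorm x"
  have r: "0 < r" "r \<le> 1" using x by (auto simp: r_def infnorm_pos_lt)
  have g: "0 < 1 - \<alpha> / N" "1 - \<alpha> / N \<le> 1"
    using fractional_exponents(3)[OF \<alpha> p q] \<alpha> by simp_all
  have "(\<integral>\<^sup>+y\<in>sup_ball r. ennreal (infnorm y powr (d - N)) \<partial>(lebesgue :: (real ^ 'n) measure)) =
    (\<integral>\<^sup>+y\<in>sup_ball r. ennreal \<bar>power_function y\<bar> \<partial>(lebesgue :: (real ^ 'n) measure))"
    using r by (intro nn_integral_cong) (auto simp: power_function_def sup_ball_def indicator_def)
  then have "ennreal (r powr d / d)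
      \<le> (\<integral>\<^sup>+y\<in>sup_ball r. ennreal \<bar>power_function y\<bar> \<partial>(lebesgue :: (real ^ 'n) measure))"
    using integral_infnorm_powr(1)[OF r(1) d(1), where 'n = 'n] d unfolding N by simp
  then have "ennreal (1 / ((2 * r) ^ N) powr (1 - \<alpha> / N)) * ennreal (r powr d / d) \<le>
    ennreal (1 / measure lebesgue (sup_ball r :: (real ^ 'n) set) powr (1 - \<alpha> / CARD('n)))
        * (\<integral>\<^sup>+y\<in>sup_ball r. ennreal \<bar>power_function y\<bar> \<partial>(lebesgue :: (real ^ 'n) measure))"
    unfolding sup_ball_measure(2)[OF r(1)] N by (rule mult_left_mono) simp
  also have "\<dots> \<le> frac_maximal \<alpha> power_function x"
    unfolding frac_maximal_def using sup_ball_cube[OF r(1)]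
        by (intro SUP_upper) (auto simp: sup_ball_def r_def)
  finally have 1: "ennreal (1 / ((2 * r) ^ N) powr (1 - \<alpha> / N)) * ennreal (r powr d / d)
      \<le> frac_maximal \<alpha> power_function x" .
  have "(1 / 2) powr N / d * r powr (d - N * (1 - \<alpha> / N))
      \<le> 1 / ((2 * r) ^ N) powr (1 - \<alpha> / N) * (r powr d / d)"
  proof -
    have "((2 * r) ^ N) powr (1 - \<alpha> / N) = 2 powr (N * (1 - \<alpha> / N)) * r powr (N * (1 - \<alpha> / N))"
      using r by (simp only: powr_realpow[symmetric] powr_powr powr_mult mult_pos_pos zero_less_numeral)
    moreover have "2 powr (N * (1 - \<alpha> / N)) \<le> 2 powr N"
      using g(2) mult_left_mono[OF g(2), of N] by simp
    ultimately show ?thesis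
      using r d by (simp add: powr_diff powr_divide frac_le)
  qed
  then have "ennreal ((1 / 2) powr N / d * r powr (d - N * (1 - \<alpha> / N)))
      \<le> ennreal (1 / ((2 * r) ^ N) powr (1 - \<alpha> / N)) * ennreal (r powr d / d)"
    using d r by (simp add: ennreal_leI flip: ennreal_mult)
  with 1 show ?thesis unfolding r_def by (rule order_trans[rotated])
qed

lemma power_function_maximal_norm:
  assumes N: "N = CARD('n)" and dq: "q * d / p \<le> 1"
  shows "ennreal ((1 / 2) powr N / d * (p / (q * d)) powr (1 / q))
      \<le> Lp_norm q (\<lambda>x :: real ^ 'n. ennreal (power_weight x) * frac_maximal \<alpha> power_function x)"
proof -
  define c where "c = (1 / 2) powr N / d"
  have c: "0 < c" using d by (simp add: c_def)
  have q0: "0 < q" using fractional_exponents(4)[OF \<alpha> p q] by simp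
  have "ennreal (c powr q * (p / (q * d)))
      = ennreal (c powr q) * ennreal (1 powr (q * d / p) / (q * d / p))"
    using c q0 p d by (simp flip: ennreal_mult)
  also have "\<dots> \<le> ennreal (c powr q)
      * (\<integral>\<^sup>+x\<in>sup_ball 1. ennreal (infnorm x powr (q
      * d / p - N)) \<partial>(lebesgue :: (real ^ 'n) measure))"
    using integral_infnorm_powr(1)[of 1 "q * d / p", where 'n = 'n] q0 d p dq unfolding N
        by (intro mult_left_mono) auto
  also have "\<dots> = (\<integral>\<^sup>+x. ennreal (c powr q)
      * (ennreal (infnorm x powr (q * d / p - N))
      * indicator (sup_ball 1) x) \<partial>(lebesgue :: (real ^ 'n) measure))"
    by (rule nn_integral_cmult[symmetric]) measurable
  also have "\<dots> \<le> (\<integral>\<^sup>+x. epowr (ennreal (power_weight x)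
      * frac_maximal \<alpha> power_function x) q \<partial>(lebesgue :: (real ^ 'n) measure))"
  proof (rule nn_integral_mono)
    fix x :: "real ^ 'n"
    show "ennreal (c powr q) * (ennreal (infnorm x powr (q * d / p - N))
        * indicator (sup_ball 1) x)
        \<le> epowr (ennreal (power_weight x) * frac_maximal \<alpha> power_function x) q"
    proof (cases "x \<noteq> 0 \<and> infnorm x \<le> 1")
      case True
      then have pos: "0 < infnorm x" by (simp add: infnorm_pos_lt)
      let ?e = "d - N * (1 - \<alpha> / N)"
      have "q * d / p - N = (power_weight_exponent + ?e) * q" using power_weight_exponents(5)
          by (simp add: algebra_simps)
      then have "c powr q * infnorm x powr (q * d / p - N)
          = (infnorm x powr power_weight_exponent * (c * infnorm x powr ?e)) powr q"
        using c pos by (simp add: powr_mult powr_powr powr_add[symmetric] mult.left_commute[of _ "c powr q"] distrib_right)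
      then have "ennreal (c powr q) * ennreal (infnorm x powr (q * d / p - N))
          = epowr (ennreal (power_weight x) * ennreal (c * infnorm x powr ?e)) q"
        using c pos by (simp add: power_weight_def epowr_ennreal_pos flip: ennreal_mult)
      also have "\<dots> \<le> epowr (ennreal (power_weight x) * frac_maximal \<alpha> power_function x) q"
        using power_function_frac_maximal[OF N, of x] True q0 unfolding c_def
            by (intro epowr_mono mult_left_mono) auto
      finally show ?thesis using True by (simp add: sup_ball_def)
    qed (auto simp: sup_ball_def infnorm_0)
  qed
  finally have "epowr (ennreal (c powr q * (p / (q * d)))) (1 / q)
      \<le> Lp_norm q (\<lambda>x :: real ^ 'n. ennreal (power_weight x) * frac_maximal \<alpha> power_function x)"
    unfolding Lp_norm_def using q0 by (intro epowr_mono) auto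
  moreover have eq: "epowr (ennreal (c powr q * y)) (1 / q) = ennreal (c * y powr (1 / q))"
      if "0 < y" for y
    using c q0 that by (subst epowr_ennreal_pos) (simp_all add: powr_mult powr_powr)
  moreover have "0 < p / (q * d)" using p(1) q0 d by simp
  ultimately show ?thesis by (simp only: eq) (simp only: c_def)
qed

end

section \<open>Sharpness of the exponent\<close>

text \<open>
  For the constant \<open>A\<close> of the power weight, \<open>A powr \<beta>\<close> is at most a constant times
  \<open>d powr (- s * q / p')\<close> with \<open>s = max \<beta> 0\<close>. Comparing the powers of \<open>d\<close> in the assumed bound gives
  \<open>k1 \<le> k2 * d powr \<eta>\<close> for all small \<open>d\<close>, where \<open>\<eta> = (\<theta> - s) * q / p'\<close> is positive.
\<close>

lemma fractional_maximal_sharp: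
  fixes \<alpha> p q :: real
  assumes \<alpha>: "0 \<le> \<alpha>" "\<alpha> < CARD('n::finite)" and p: "1 < p" "\<alpha> = 0 \<or> p < CARD('n) / \<alpha>"
    and q: "1 / q = 1 / p - \<alpha> / CARD('n)"
    and \<beta>: "\<beta> < conj_exponent p / q * (1 - \<alpha> / CARD('n))"
    and bound: "\<And>w f. w \<in> Apq p q \<Longrightarrow> in_Lp p (\<lambda>x. w x * f x) \<Longrightarrow>
      Lp_norm q (\<lambda>x :: real ^ 'n. ennreal (w x) * frac_maximal \<alpha> f x)
        \<le> ennreal c * epowr (Apq_const p q w) \<beta> * Lp_norm p (\<lambda>x. ennreal \<bar>w x * f x\<bar>)"
  shows False
proof -
  define N where "N = CARD('n)"
  note ex = fractional_exponents[OF \<alpha> p q, folded N_def]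
  note hyps = \<alpha>[folded N_def] p(1) p(2)[folded N_def] q[folded N_def]
  define p' where "p' = conj_exponent p"
  have p': "1 < p'" using p by (simp add: p'_def conj_exponent_def field_simps)
  have q0: "0 < q" using ex by simp
  define s where "s = max \<beta> 0"
  define c3 where "c3 = (if 0 \<le> \<beta> then 1 else ((1 / 2) powr (N * q)) powr \<beta>)"
  \<comment> \<open>The constant \<open>c\<close> need not be positive, in which case \<open>ennreal c\<close> is \<open>0\<close>.\<close>
  define c0 where "c0 = max c 1"
  define k1 where "k1 = (1 / 2) powr N * (p / q) powr (1 / q)"
  define k2 where "k2 = c0 * c3 * power_weight_const N powr (s * (q / p'))
      * (4 ^ (N + 1)) powr (1 / p)"
  define \<eta> where "\<eta> = 1 + 1 / q - 1 / p - s * (q / p')"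
  have C: "0 < power_weight_const N" by (simp add: power_weight_const_def)
  have c3: "0 < c3" by (simp add: c3_def)
  have k: "0 < k1" "0 < k2" using p q0 C c3 by (auto simp: k1_def k2_def c0_def)
  have \<eta>: "0 < \<eta>"
  proof -
    have th: "p' / q * (1 - \<alpha> / N) * (q / p') = 1 - \<alpha> / N" using p' q0 by simp
    have "0 < p' / q * (1 - \<alpha> / N)" using p' q0 ex(3) by simp
    then have "s < p' / q * (1 - \<alpha> / N)" using \<beta> by (simp add: s_def p'_def N_def)
    then have "s * (q / p') < p' / q * (1 - \<alpha> / N) * (q / p')"
      using p' q0 by (intro mult_strict_right_mono) auto
    then have "s * (q / p') < 1 - \<alpha> / N" unfolding th .
    then show ?thesis using q by (simp add: \<eta>_def N_def)
  qed
  have main: "k1 \<le> k2 * d powr \<eta>" if d: "0 < d" "d < 1" "q * d / p \<le> 1" for d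
  proof -
    note H = hyps d(1,2)
    define w where "w = (power_weight p d N :: real ^ 'n \<Rightarrow> real)"
    define f where "f = (power_function d N :: real ^ 'n \<Rightarrow> real)"
    define A where "A = Apq_const p q w"
    have up: "A \<le> ennreal ((power_weight_const N / d) powr (q / p'))"
      unfolding A_def w_def p'_def by (rule power_weight_Apq_upper[OF H N_def])
    have lo: "ennreal ((1 / 2) powr (N * q)) \<le> A"
      unfolding A_def w_def by (rule power_weight_Apq_lower[OF H N_def])
    have w: "w \<in> Apq p q"
      using up weight_power_weight[OF H]
          by (auto simp: Apq_def A_def w_def intro: order.strict_trans1)
    obtain a where a: "A = ennreal a" "0 \<le> a" using up by (cases A) (auto simp: top_unique)
    have a_bounds: "(1 / 2) powr (N * q) \<le> a" "a \<le> (power_weight_const N / d) powr (q / p')"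
      using lo up a C d by (simp_all add: ennreal_le_iff)
    have a0: "0 < a" using a_bounds(1) powr_gt_zero[of "1/2" "N * q"] by linarith
    have "a powr \<beta> \<le> c3 * (power_weight_const N / d) powr (s * (q / p'))"
    proof (cases "0 \<le> \<beta>")
      case True
      then have "a powr \<beta> \<le> ((power_weight_const N / d) powr (q / p')) powr \<beta>"
        using a_bounds a0 by (intro powr_mono2) auto
      then show ?thesis using True by (simp add: c3_def s_def powr_powr mult.commute)
    next
      case False
      then have "a powr \<beta> \<le> ((1 / 2) powr (N * q)) powr \<beta>"
        using a_bounds a0 by (intro powr_mono2') auto
      then show ?thesis using False C d by (simp add: c3_def s_def)
    qed
    then have A: "epowr A \<beta> \<le> ennreal (c3 * (power_weight_const N / d) powr (s * (q / p')))"
      using a a0 by (simp add: epowr_ennreal_pos ennreal_leI)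
    have "ennreal ((1 / 2) powr N / d * (p / (q * d)) powr (1 / q))
        \<le> Lp_norm q (\<lambda>x. ennreal (w x) * frac_maximal \<alpha> f x)"
      unfolding w_def f_def by (rule power_function_maximal_norm[OF H N_def d(3)])
    also have "\<dots> \<le> ennreal c * epowr A \<beta> * Lp_norm p (\<lambda>x. ennreal \<bar>w x * f x\<bar>)"
      using bound[OF w, of f] power_weight_norm(1)[OF H N_def] by (simp add: A_def w_def f_def)
    also have "\<dots> \<le> ennreal c0 * ennreal (c3 * (power_weight_const N / d) powr (s * (q / p')))
        * ennreal ((4 ^ (N + 1) / d) powr (1 / p))"
    proof (intro mult_mono A)
      show "Lp_norm p (\<lambda>x. ennreal \<bar>w x * f x\<bar>) \<le> ennreal ((4 ^ (N + 1) / d) powr (1 / p))"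
        unfolding w_def f_def by (rule power_weight_norm(2)[OF H N_def])
    qed (auto simp: c0_def ennreal_leI)
    also have "\<dots> = ennreal (c0 * (c3 * (power_weight_const N / d) powr (s * (q / p')))
        * (4 ^ (N + 1) / d) powr (1 / p))"
      using c3 by (simp add: c0_def flip: ennreal_mult)
    finally have "(1 / 2) powr N / d * (p / (q * d)) powr (1 / q)
        \<le> c0 * (c3 * (power_weight_const N / d) powr (s * (q / p')))
        * (4 ^ (N + 1) / d) powr (1 / p)"
      using c3 by (subst (asm) ennreal_le_iff) (auto simp: c0_def)
    moreover have "(1 / 2) powr N / d * (p / (q * d)) powr (1 / q) = k1 * d powr (- 1 - 1 / q)"
    proof -
      have "(p / (q * d)) powr (1 / q) = (p / q) powr (1 / q) / d powr (1 / q)"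
        using p q0 d powr_divide[of "p / q" d "1 / q"] by simp
      moreover have "d powr (- 1 - 1 / q) = 1 / (d * d powr (1 / q))"
        using d by (simp add: powr_diff powr_minus field_simps)
      ultimately show ?thesis by (simp add: k1_def)
    qed
    moreover have "c0 * (c3 * (power_weight_const N / d) powr (s * (q / p')))
        * (4 ^ (N + 1) / d) powr (1 / p) = k2 * d powr (- (s * (q / p')) - 1 / p)"
    proof -
      have "(power_weight_const N / d) powr (s * (q / p'))
          = power_weight_const N powr (s * (q / p')) / d powr (s * (q / p'))"
        "(4 ^ (N + 1) / d) powr (1 / p) = (4 ^ (N + 1)) powr (1 / p) / d powr (1 / p)"
        using C d by (simp_all only: powr_divide less_imp_le)
      moreover have "d powr (- (s * (q / p')) - 1 / p)
          = 1 / (d powr (s * (q / p')) * d powr (1 / p))"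
        by (simp add: powr_diff powr_minus_divide)
      ultimately show ?thesis by (simp only: k2_def) simp
    qed
    ultimately have "k1 * d powr (- 1 - 1 / q) \<le> k2 * d powr (- (s * (q / p')) - 1 / p)" by simp
    then have "k1 * d powr (- 1 - 1 / q) * d powr (1 + 1 / q)
        \<le> k2 * d powr (- (s * (q / p')) - 1 / p) * d powr (1 + 1 / q)"
      by (rule mult_right_mono) simp
    then have "k1 * d powr ((- 1 - 1 / q) + (1 + 1 / q))
        \<le> k2 * d powr ((- (s * (q / p')) - 1 / p) + (1 + 1 / q))"
      by (simp only: mult.assoc powr_add)
    moreover have "(- 1 - 1 / q) + (1 + 1 / q) = 0" "(- (s * (q / p')) - 1 / p) + (1 + 1 / q) = \<eta>"
      by (simp_all add: \<eta>_def)
    ultimately show ?thesis using d by simp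
  qed
  \<comment> \<open>The last entry makes \<open>k2 * d powr \<eta>\<close> at most \<open>k1 / 2\<close>.\<close>
  define d where "d = min (1 / 2) (min (p / q) ((k1 / (2 * k2)) powr (1 / \<eta>)))"
  have d: "0 < d" "d < 1" "d \<le> p / q" "d \<le> (k1 / (2 * k2)) powr (1 / \<eta>)"
    using k p q0 by (auto simp: d_def)
  have "q * d / p \<le> 1" using d(3) p q0 by (simp add: field_simps)
  then have "k1 \<le> k2 * d powr \<eta>" using main d by blast
  also have "d powr \<eta> \<le> ((k1 / (2 * k2)) powr (1 / \<eta>)) powr \<eta>"
    using d \<eta> by (intro powr_mono2) auto
  also have "((k1 / (2 * k2)) powr (1 / \<eta>)) powr \<eta> = k1 / (2 * k2)"
    using k \<eta> by (simp add: powr_powr)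
  finally have "k1 \<le> k2 * (k1 / (2 * k2))" using k by simp
  then show False using k by simp
qed

theorem theorem2p9:
  fixes \<alpha> p q :: real
  assumes "0 \<le> \<alpha>" and "\<alpha> < CARD('n::finite)"
    and "1 < p" and "\<alpha> = 0 \<or> p < CARD('n) / \<alpha>"
    and "1 / q = 1 / p - \<alpha> / CARD('n)"
  shows
    "(\<exists>c::real. \<forall>w \<in> Apq p q. \<forall>f :: real ^ 'n \<Rightarrow> real. in_Lp p (\<lambda>x. w x * f x) \<longrightarrow>
        Lp_norm q (\<lambda>x. ennreal (w x) * frac_maximal \<alpha> f x)
        \<le> ennreal c * epowr (Apq_const p q w) (conj_exponent p / q * (1 - \<alpha> / CARD('n)))
            * Lp_norm p (\<lambda>x. ennreal \<bar>w x * f x\<bar>))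
     \<and> (\<forall>\<beta> < conj_exponent p / q * (1 - \<alpha> / CARD('n)).
        \<not> (\<exists>c::real. \<forall>w \<in> Apq p q. \<forall>f :: real ^ 'n \<Rightarrow> real. in_Lp p (\<lambda>x. w x * f x) \<longrightarrow>
            Lp_norm q (\<lambda>x. ennreal (w x) * frac_maximal \<alpha> f x)
            \<le> ennreal c * epowr (Apq_const p q w) \<beta>
                * Lp_norm p (\<lambda>x. ennreal \<bar>w x * f x\<bar>)))"
proof (intro conjI allI impI notI)
  show "\<exists>c::real. \<forall>w \<in> Apq p q. \<forall>f :: real ^ 'n \<Rightarrow> real. in_Lp p (\<lambda>x. w x * f x) \<longrightarrow>
        Lp_norm q (\<lambda>x. ennreal (w x) * frac_maximal \<alpha> f x)
        \<le> ennreal c * epowr (Apq_const p q w) (conj_exponent p / q * (1 - \<alpha> / CARD('n)))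
            * Lp_norm p (\<lambda>x. ennreal \<bar>w x * f x\<bar>)"
    by (intro exI ballI allI impI, rule fractional_maximal_bound[OF assms]; assumption)
next
  fix \<beta> assume \<beta>: "\<beta> < conj_exponent p / q * (1 - \<alpha> / CARD('n))"
    and ex: "\<exists>c::real. \<forall>w \<in> Apq p q. \<forall>f :: real ^ 'n \<Rightarrow> real. in_Lp p (\<lambda>x. w x * f x) \<longrightarrow>
            Lp_norm q (\<lambda>x. ennreal (w x) * frac_maximal \<alpha> f x)
            \<le> ennreal c * epowr (Apq_const p q w) \<beta> * Lp_norm p (\<lambda>x. ennreal \<bar>w x * f x\<bar>)"
  from ex obtain c :: real where c: "\<forall>w \<in> Apq p q. \<forall>f :: real ^ 'n \<Rightarrow> real. in_Lp p (\<lambda>x. w x * f x) \<longrightarrow>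
            Lp_norm q (\<lambda>x. ennreal (w x) * frac_maximal \<alpha> f x)
            \<le> ennreal c * epowr (Apq_const p q w) \<beta> * Lp_norm p (\<lambda>x. ennreal \<bar>w x * f x\<bar>)"
                by (elim exE)
  show False
    by (rule fractional_maximal_sharp[OF assms \<beta>, of c]) (rule c[rule_format])
qed

end
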